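(* Let $A,B>0$ and $\gamma\in(0,1)$ be constants, and let $\mu$ be a nontrivial (i.e. not finitely supported) probability measure on the unit circle $\partial\mathbb{D}$ whose Verblunsky coefficients $\{\alpha_n\}_{n\ge 0}$ satisfy $$\sum_{n=0}^N n^\gamma|\alpha_n|^2\le A(\log N)^B\qquad\text{for all integers } N\ge 2 .$$ Then there is a set $S\subset\partial\mathbb{D}$ of Hausdorff dimension at most $2(1-\gamma)$ such that for every $z\in\partial\mathbb{D}\setminus S$, $$\sup_{n\ge 0}\|T_n(z)\|<\infty ,$$ where $T_n(z)$ are the Szegő matrices associated with $\mu$. In particular, the singular part $\mu_{\mathrm{sing}}$ of $\mu$ (with respect to Lebesgue measure on $\partial\mathbb{D}$) is supported by a set of Hausdorff dimension at most $2(1-\gamma)$.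
   Context: $\mathbb{D}=\{z\in\mathbb{C}:|z|<1\}$ and $\partial\mathbb{D}=\{z\in\mathbb{C}:|z|=1\}$. For a nontrivial probability measure $\mu$ on $\partial\mathbb{D}$, let $\Phi_n(z)$ be the monic orthogonal polynomials in $L^2(\partial\mathbb{D},\mu)$ obtained by applying Gram-Schmidt to $1,z,z^2,\dots$. For a polynomial $P$ of degree $n$ (here $P=\Phi_n,\varphi_n,\psi_n$), the Szegő dual is $P^*(z)=z^n\overline{P(1/\overline{z})}$. The Verblunsky coefficients are the unique numbers $\alpha_n\in\mathbb{D}$, $n \ge 0$, with $\Phi_{n+1}(z)=z\Phi_n(z)-\overline{\alpha}_n\Phi_n^*(z)$; conversely every sequence in $\mathbb{D}$ is the sequence of Verblunsky coefficients of some nontrivial probability measure on $\partial\mathbb{D}$. The orthonormal polynomials are $\varphi_n=\Phi_n/\|\Phi_n\|_{L^2(\mu)}$; with $\rho_n=(1-|\alpha_n|^2)^{1/2}$ they satisfy $\varphi_0 = 1$ and $$\begin{bmatrix}\varphi_{n+1}(z)\\ \varphi_{n+1}^*(z)\end{bmatrix}=\frac{1}{\rho_n}\begin{bmatrix} z & -\overline{\alpha}_n\\ -\alpha_n z & 1\end{bmatrix}\begin{bmatrix}\varphi_n(z)\\ \varphi_n^*(z)\end{bmatrix}.$$ The polynomials of the second kind $\psi_n$ are defined by $\psi_0=1$ and $$\begin{bmatrix}\psi_{n+1}(z)\\ -\psi_{n+1}^*(z)\end{bmatrix}=\frac{1}{\rho_n}\begin{bmatrix} z & -\overline{\alpha}_n\\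 -\alpha_n z & 1\end{bmatrix}\begin{bmatrix}\psi_n(z)\\ -\psi_n^*(z)\end{bmatrix};$$ equivalently, they are the orthonormal polynomials of the measure with Verblunsky coefficients $-\alpha_n$. The Szegő matrices are $$T_n(z)=\frac12\begin{bmatrix}\varphi_n(z)+\psi_n(z) & \varphi_n(z)-\psi_n(z)\\ \varphi_n^*(z)-\psi_n^*(z) & \varphi_n^*(z)+\psi_n^*(z)\end{bmatrix},\quad n\ge 0,$$ and $\|\cdot\|$ is any fixed matrix norm. A measure is supported by a set if it gives zero mass to the complement of the set. *)

theory Defs
  imports
    "HOL-Probability.Probability"
    "HOL-Computational_Algebra.Polynomial"
begin

section \<open>Measures on the unit circle\<close>

abbreviation circle_borel :: "complex measure" where
  "circle_borel \<equiv> restrict_space borel (sphere 0 1)"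

text \<open>Arc length measure; its total mass is \<open>2 * pi\<close>.\<close>
definition circle_lebesgue :: "complex measure" where
  "circle_lebesgue = distr (restrict_space lborel {0..<2 * pi}) circle_borel cis"

text \<open>Membership in \<^const>\<open>null_sets\<close> rather than \<open>emeasure M (space M - S) = 0\<close>:
  \<^const>\<open>emeasure\<close> vanishes on every non-measurable set.\<close>
definition supported_by :: "'a measure \<Rightarrow> 'a set \<Rightarrow> bool" where
  "supported_by M S \<longleftrightarrow> space M - S \<in> null_sets M"

definition nontrivial_circle_prob :: "complex measure \<Rightarrow> bool" where
  "nontrivial_circle_prob M \<longleftrightarrow>
     sets M = sets circle_borel \<and> prob_space M \<and> \<not> (\<exists>F. finite F \<and> supported_by M F)"

definition mutually_singular :: "'a measure \<Rightarrow> 'a measure \<Rightarrow> bool" where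
  "mutually_singular L N \<longleftrightarrow> (\<exists>E\<in>null_sets L. supported_by N E)"

text \<open>The singular component of the Lebesgue decomposition of \<open>M\<close> with respect to \<open>L\<close>.\<close>
definition singular_part :: "'a measure \<Rightarrow> 'a measure \<Rightarrow> 'a measure" where
  "singular_part L M = (THE N. sets N = sets M \<and> mutually_singular L N \<and>
     (\<exists>K. sets K = sets M \<and> absolutely_continuous L K \<and>
          (\<forall>A\<in>sets M. emeasure M A = emeasure K A + emeasure N A)))"

section \<open>Hausdorff dimension\<close>

text \<open>The conventions are that the empty set contributes \<open>0\<close> and that a nonempty set contributes
  \<open>1\<close> for \<open>s = 0\<close>, whereas \<open>0 powr 0 = 0\<close>.\<close>
definition diam_powr :: "real \<Rightarrow> 'a::metric_space set \<Rightarrow> real" where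
  "diam_powr s U = (if U = {} then 0 else if s = 0 then 1 else diameter U powr s)"

text \<open>Boundedness is required explicitly because \<^const>\<open>diameter\<close> is meaningless on
  unbounded sets.\<close>
definition hausdorff_premeasure :: "real \<Rightarrow> real \<Rightarrow> 'a::metric_space set \<Rightarrow> ennreal" where
  "hausdorff_premeasure s \<delta> S =
     (INF U\<in>{U :: nat \<Rightarrow> 'a set. S \<subseteq> (\<Union>i. U i) \<and> (\<forall>i. bounded (U i) \<and> diameter (U i) \<le> \<delta>)}.
        \<Sum>i. ennreal (diam_powr s (U i)))"

definition hausdorff_measure :: "real \<Rightarrow> 'a::metric_space set \<Rightarrow> ennreal" where
  "hausdorff_measure s S = (SUP \<delta>\<in>{0<..}. hausdorff_premeasure s \<delta> S)"

definition hausdorff_dim :: "'a::metric_space set \<Rightarrow> ennreal" where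
  "hausdorff_dim S = (INF s\<in>{s. 0 \<le> s \<and> hausdorff_measure s S = 0}. ennreal s)"

section \<open>Orthogonal polynomials on the unit circle\<close>

text \<open>The inner product is linear in the second argument.\<close>
definition l2_inner :: "complex measure \<Rightarrow> complex poly \<Rightarrow> complex poly \<Rightarrow> complex" where
  "l2_inner M p q = (LINT z|M. cnj (poly p z) * poly q z)"

definition l2_norm :: "complex measure \<Rightarrow> complex poly \<Rightarrow> real" where
  "l2_norm M p = sqrt (LINT z|M. (cmod (poly p z))\<^sup>2)"

text \<open>Gram-Schmidt without normalization applied to \<open>1, z, z^2, \<dots>\<close>.\<close>
fun monic_op :: "complex measure \<Rightarrow> nat \<Rightarrow> complex poly" where
  "monic_op M n = monom 1 n -
     (\<Sum>k<n. smult (l2_inner M (monic_op M k) (monom 1 n) / l2_inner M (monic_op M k) (monic_op M k))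
              (monic_op M k))"

declare monic_op.simps [simp del]

definition orthonormal_op :: "complex measure \<Rightarrow> nat \<Rightarrow> complex poly" where
  "orthonormal_op M n = smult (complex_of_real (1 / l2_norm M (monic_op M n))) (monic_op M n)"

text \<open>The dual is taken with respect to the exact degree of the polynomial.\<close>
definition szego_dual :: "complex poly \<Rightarrow> complex poly" where
  "szego_dual p = reflect_poly (map_poly cnj p)"

lemma degree_map_poly_cnj [simp]: "degree (map_poly cnj p) = degree p"
  by (rule degree_map_poly) auto

lemma poly_szego_dual:
  "z \<noteq> 0 \<Longrightarrow> poly (szego_dual p) z = z ^ degree p * cnj (poly p (1 / cnj z))"
  by (simp add: szego_dual_def poly_reflect_poly_nz divide_inverse)

definition verblunsky :: "complex measure \<Rightarrow> nat \<Rightarrow> complex" where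
  "verblunsky M n = (THE a. cmod a < 1 \<and>
     monic_op M (Suc n) = pCons 0 (monic_op M n) - smult (cnj a) (szego_dual (monic_op M n)))"

text \<open>Only the first row of the defining matrix recursion is used, with the Szego dual for the
  second entry; the second row follows, see \<open>szego_dual_second_kind_Suc\<close> below.\<close>
primrec second_kind :: "(nat \<Rightarrow> complex) \<Rightarrow> nat \<Rightarrow> complex poly" where
  "second_kind \<alpha> 0 = 1"
| "second_kind \<alpha> (Suc n) = smult (complex_of_real (1 / sqrt (1 - (cmod (\<alpha> n))\<^sup>2)))
     (pCons 0 (second_kind \<alpha> n) + smult (cnj (\<alpha> n)) (szego_dual (second_kind \<alpha> n)))"

lemma degree_second_kind:
  assumes "\<forall>n. cmod (\<alpha> n) < 1"
  shows "degree (second_kind \<alpha> n) = n \<and> second_kind \<alpha> n \<noteq> 0"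
proof (induction n)
  case (Suc n)
  have *: "(cmod (\<alpha> n))\<^sup>2 \<noteq> 1"
    using assms[rule_format, of n] norm_ge_zero[of "\<alpha> n"]
    by (auto simp: power2_eq_1_iff simp del: norm_ge_zero)
  have "degree (smult (cnj (\<alpha> n)) (szego_dual (second_kind \<alpha> n))) \<le> n"
    using Suc degree_reflect_poly_le[of "map_poly cnj (second_kind \<alpha> n)"]
    by (intro order.trans[OF degree_smult_le]) (simp add: szego_dual_def)
  moreover have "degree (pCons 0 (second_kind \<alpha> n)) = Suc n"
    using Suc by simp
  ultimately have "degree (pCons 0 (second_kind \<alpha> n) +
      smult (cnj (\<alpha> n)) (szego_dual (second_kind \<alpha> n))) = Suc n"
    by (subst degree_add_eq_left) auto
  with * show ?case
    by (auto simp: degree_smult_eq)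
qed simp

lemma coeff_szego_dual:
  "coeff (szego_dual p) i = (if i \<le> degree p then cnj (coeff p (degree p - i)) else 0)"
  by (simp add: szego_dual_def coeff_reflect_poly coeff_map_poly)

lemma szego_dual_smult_of_real:
  "szego_dual (smult (complex_of_real c) p) = smult (complex_of_real c) (szego_dual p)"
  by (cases "c = 0") (auto simp: poly_eq_iff coeff_szego_dual)

lemma szego_dual_second_kind_Suc:
  assumes "\<forall>n. cmod (\<alpha> n) < 1"
  shows "- szego_dual (second_kind \<alpha> (Suc n)) =
    smult (complex_of_real (1 / sqrt (1 - (cmod (\<alpha> n))\<^sup>2)))
     (smult (- \<alpha> n) (pCons 0 (second_kind \<alpha> n)) - szego_dual (second_kind \<alpha> n))"
proof -
  define c where "c = 1 / sqrt (1 - (cmod (\<alpha> n))\<^sup>2)"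
  define p where "p = second_kind \<alpha> n"
  define q where "q = pCons 0 p + smult (cnj (\<alpha> n)) (szego_dual p)"
  have pq: "second_kind \<alpha> (Suc n) = smult (complex_of_real c) q"
    by (simp add: c_def p_def q_def)
  have dp: "degree p = n"
    using degree_second_kind[OF assms, of n] by (simp add: p_def)
  have dq: "degree q = Suc n"
    using degree_second_kind[OF assms, of "Suc n"] unfolding pq by (auto split: if_splits)
  have "coeff (szego_dual q) i = coeff (smult (\<alpha> n) (pCons 0 p) + szego_dual p) i" for i
  proof (cases i)
    case (Suc j)
    consider "j < n" | "j = n" | "n < j" by linarith
    then show ?thesis
    proof cases
      case 1
      then obtain d where "n = Suc (j + d)"
        using less_iff_Suc_add by auto
      with Suc show ?thesis
        by (simp add: coeff_szego_dual dq dp) (simp add: q_def coeff_szego_dual dp)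
    next
      case 2
      with Suc show ?thesis
        by (simp add: coeff_szego_dual dq dp) (simp add: q_def coeff_szego_dual dp)
    next
      case 3
      with Suc show ?thesis
        by (simp add: coeff_szego_dual dq dp coeff_eq_0)
    qed
  qed (simp add: coeff_szego_dual dq dp, simp add: q_def coeff_szego_dual dp)
  then have "szego_dual q = smult (\<alpha> n) (pCons 0 p) + szego_dual p"
    by (rule poly_eqI)
  then show ?thesis
    unfolding pq szego_dual_smult_of_real unfolding c_def[symmetric] p_def[symmetric]
    by (simp add: smult_add_right smult_diff_right)
qed

definition szego_matrix :: "complex measure \<Rightarrow> nat \<Rightarrow> complex \<Rightarrow> complex^2^2" where
  "szego_matrix M n z =
     (let \<phi> = orthonormal_op M n; \<psi> = second_kind (verblunsky M) n;
          \<phi>' = szego_dual \<phi>; \<psi>' = szego_dual \<psi>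
      in vector [vector [(poly \<phi> z + poly \<psi> z) / 2, (poly \<phi> z - poly \<psi> z) / 2],
                 vector [(poly \<phi>' z - poly \<psi>' z) / 2, (poly \<phi>' z + poly \<psi>' z) / 2]])"

text \<open>An arbitrary norm on the complex vector space of matrices; submultiplicativity is not
  required.\<close>
definition matrix_norm :: "(complex^'n^'m \<Rightarrow> real) \<Rightarrow> bool" where
  "matrix_norm N \<longleftrightarrow>
     (\<forall>A. 0 \<le> N A) \<and> (\<forall>A. N A = 0 \<longleftrightarrow> A = 0) \<and>
     (\<forall>c A. N (\<chi> i j. c * A $ i $ j) = cmod c * N A) \<and>
     (\<forall>A B. N (A + B) \<le> N A + N B)"

end

theory Submission
  imports Defs
begin

text \<open>On the circle both \<open>\<phi>\<^sub>n\<close> and \<open>\<psi>\<^sub>n\<close> stay bounded at \<open>z\<close> as soon as the tails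
  \<open>x\<^sub>m\<close> of \<open>\<Sum>\<alpha>\<^sub>j z^(j+1)\<close> satisfy \<open>\<Sum>\<bar>\<alpha>\<^sub>m\<bar> \<bar>x (m + 1)\<bar> < \<infinity>\<close> (a Harris-Lutz transformation).
  For \<open>s > 2 (1 - \<gamma>)\<close> this holds once the partial sums over the dyadic block \<open>[2^k, 2^(k+1)]\<close> are
  at most a constant times \<open>2^(- s k / 4)\<close> for all large \<open>k\<close>. By the Rademacher-Menshov inequality on the
  grid of roots of unity of order \<open>2^k\<close>, this fails only on so few arcs of length \<open>2 pi / 2^k\<close> that
  the limsup of the bad arcs has vanishing \<open>s\<close>-dimensional Hausdorff measure.

  Where \<open>\<phi>\<^sub>n\<close> and \<open>\<psi>\<^sub>n\<close> are bounded, the Wronskian identity bounds \<open>\<bar>\<phi>\<^sub>n\<bar>\<close> from below, and the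
  Christoffel-Darboux kernel shows that \<open>\<mu>\<close> gives balls of radius \<open>r\<close> mass \<open>O(r)\<close>. Hence \<open>\<mu>\<close> is
  absolutely continuous there, and its singular part lives on the exceptional set.\<close>

section \<open>Boundedness of solutions of the Szego recursion\<close>

text \<open>Origin of the threshold: the block energies decay like \<open>2 ^ (- \<eta> k)\<close>
  with \<eta> slightly below \<gamma>, the gap absorbing the power of the logarithm. If block sums
  up to \<open>q ^ k\<close> are tolerated, Cauchy-Schwarz over the \<open>2 ^ k\<close> indices of
  a block makes the Harris-Lutz series converge when \<open>q^2 < 2 ^ (\<eta> - 1)\<close>.
  Chebyshev leaves about \<open>(k + 1)^2 * (2 ^ (1 - \<eta>) / q^2) ^ k\<close> bad arcs, whose
  s-dimensional costs are summable when \<open>q^2 > 2 ^ (1 - \<eta> - s)\<close>. Both demands can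
  be met exactly for \<open>s > 2 (1 - \<eta>)\<close>, and \<open>q^2 = 2 ^ (- s / 2)\<close> is
  the geometric mean of the two bounds. A grid of order \<open>2 ^ k\<close> has as many points as
  the block has frequencies: orthogonality on it is exact, and a bound at a grid point still carries
  over to the adjacent arc. The mass bound has a constant depending on the bound for the solutions,
  and it holds only around good points. Hence the good points are split into countably many pieces
  by an integer bound, and null sets are covered by balls centred inside the piece.\<close>

text \<open>The first row of the Szego recursion on the circle, where the dual of \<open>\<phi>\<^sub>n\<close> takes the value
  \<open>z^n * cnj (\<phi>\<^sub>n z)\<close>. The polynomials of the second kind obey it with \<open>- \<alpha>\<close>.\<close>
primrec szego_rec :: "(nat \<Rightarrow> complex) \<Rightarrow> complex \<Rightarrow> nat \<Rightarrow> complex" where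
  "szego_rec \<alpha> z 0 = 1"
| "szego_rec \<alpha> z (Suc n) =
     (z * szego_rec \<alpha> z n - cnj (\<alpha> n) * z ^ n * cnj (szego_rec \<alpha> z n)) /
       complex_of_real (sqrt (1 - (cmod (\<alpha> n))\<^sup>2))"

text \<open>Turns the normalisation of one Szego step into a factor
  \<open>exp ((cmod (\<alpha> n))\<^sup>2)\<close> with summable exponent. Up to 1/2 one has
  \<open>ln (1 - t) \<ge> - t - 2 * t^2\<close>.\<close>

lemma exp_le_inverse_sqrt:
  fixes t :: real
  assumes "0 \<le> t" "t \<le> 1 / 2"
  shows "1 / sqrt (1 - t) \<le> exp t"
proof -
  have "t * t \<le> t * (1/2)" using assms by (intro mult_left_mono) auto
  then have "- 2 * t \<le> ln (1 - t)"
    using ln_one_minus_pos_lower_bound[of t] assms by (simp add: power2_eq_square)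
  then have "exp (- 2 * t) \<le> 1 - t"
    using assms by (subst (asm) ln_ge_iff) auto
  then have "sqrt (exp (- 2 * t)) \<le> sqrt (1 - t)" by simp
  moreover have "sqrt (exp (- 2 * t)) = exp (- t)"
    by (rule real_sqrt_unique) (auto simp: power2_eq_square simp flip: exp_add)
  ultimately have "exp (- t) \<le> sqrt (1 - t)" by (simp only:)
  then have "1 / sqrt (1 - t) \<le> 1 / exp (- t)"
    using assms by (intro divide_left_mono mult_pos_pos) auto
  then show ?thesis by (simp add: exp_minus field_simps)
qed

text \<open>A discrete Gronwall inequality; the finitely many terms before \<open>m\<close> cannot
  spoil boundedness.\<close>

lemma Bseq_if_growth_summable:
  fixes W c :: "nat \<Rightarrow> real"
  assumes "\<And>n. n \<ge> m \<Longrightarrow> W (Suc n) \<le> W n * exp (c n)" "\<And>n. 0 \<le> W n" "\<And>n. 0 \<le> c n" "summable c"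
  shows "Bseq W"
proof -
  have "W (n + m) \<le> W m * exp (\<Sum>j<n. c (j + m))" for n
  proof (induction n)
    case (Suc n)
    have "W (Suc n + m) \<le> W (n + m) * exp (c (n + m))" using assms(1)[of "n + m"] by simp
    also have "\<dots> \<le> (W m * exp (\<Sum>j<n. c (j + m))) * exp (c (n + m))"
      using Suc by (intro mult_right_mono) auto
    finally show ?case by (simp add: exp_add mult.assoc)
  qed simp
  moreover have "W m * exp (\<Sum>j<n. c (j + m)) \<le> W m * exp (\<Sum>j. c (j + m))" for n
    using assms by (intro mult_left_mono) (auto intro!: sum_le_suminf summable_ignore_initial_segment)
  ultimately have "norm (W (n + m)) \<le> W m * exp (\<Sum>j. c (j + m))" for n
    using assms(2) by (metis abs_of_nonneg order_trans real_norm_def)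
  then have "Bseq (\<lambda>n. W (n + m))" by (rule BseqI')
  then show ?thesis by (rule Bseq_offset)
qed

text \<open>A Harris-Lutz transformation: with \<open>v\<^sub>n = z^n * cnj f\<^sub>n\<close> and \<open>x\<^sub>n\<close> the tail of
  \<open>\<Sum>\<alpha>\<^sub>j z^(j+1)\<close>, the sequence \<open>w\<^sub>n = v\<^sub>n - x\<^sub>n cnj v\<^sub>n\<close> obeys a recursion whose
  perturbation has the summable coefficients \<open>x (n + 1) * cnj (\<alpha>\<^sub>n z^(n+1))\<close>.\<close>
lemma Bseq_szego_rec:
  fixes \<alpha> :: "nat \<Rightarrow> complex" and z :: complex
  defines "x \<equiv> \<lambda>n. \<Sum>j. \<alpha> (j + n) * z ^ (j + n + 1)"
  assumes z: "cmod z = 1" and \<alpha>: "\<And>n. cmod (\<alpha> n) < 1"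
    and sq: "summable (\<lambda>n. (cmod (\<alpha> n))\<^sup>2)"
    and su: "summable (\<lambda>n. \<alpha> n * z ^ (n + 1))"
    and pr: "summable (\<lambda>n. cmod (\<alpha> n) * cmod (x (Suc n)))"
  shows "Bseq (szego_rec \<alpha> z)"
proof -
  define a where "a n = \<alpha> n * z ^ (n + 1)" for n
  define f where "f = szego_rec \<alpha> z"
  define v where "v n = z ^ n * cnj (f n)" for n
  define r where "r n = sqrt (1 - (cmod (\<alpha> n))\<^sup>2)" for n
  define w where "w n = v n - x n * cnj (v n)" for n
  have zc: "z * cnj z = 1" using z by (simp add: complex_norm_square[symmetric])
  have zcn: "z ^ n * cnj z ^ n = 1" for n using zc by (metis power_mult_distrib power_one)
  have r: "r n > 0" for n
    using \<alpha>[of n] by (simp add: r_def power_less_one_iff abs_square_less_1)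
  have na: "cmod (a n) = cmod (\<alpha> n)" for n by (simp add: a_def norm_mult norm_power z)
  have vS: "of_real (r n) * v (Suc n) = v n - a n * cnj (v n)" for n
  proof -
    have "of_real (r n) * v (Suc n) = z ^ Suc n * (cnj z * cnj (f n) - \<alpha> n * cnj z ^ n * f n)"
      using r[of n] by (simp add: v_def f_def r_def)
    also have "\<dots> = z ^ n * ((z * cnj z) * cnj (f n)) - \<alpha> n * z ^ Suc n * (cnj z ^ n * f n)"
      by (simp add: algebra_simps)
    also have "\<dots> = v n - a n * cnj (v n)" unfolding zc by (simp add: v_def a_def)
    finally show ?thesis .
  qed
  have xS: "x n = a n + x (Suc n)" for n
  proof -
    have "summable (\<lambda>j. \<alpha> (j + n) * z ^ (j + n + 1))"
      using su by (rule summable_ignore_initial_segment)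
    from suminf_split_head[OF this] show ?thesis by (simp add: x_def a_def)
  qed
  \<comment> \<open>First-order terms cancel: \<open>a n * cnj (v n)\<close> and
    \<open>x (Suc n) * cnj (v n)\<close> merge into \<open>x n * cnj (v n)\<close> because
    \<open>x n = a n + x (Suc n)\<close>. What survives is of second order.\<close>
  have wS: "of_real (r n) * w (Suc n) = w n + x (Suc n) * cnj (a n) * v n" for n
  proof -
    have "of_real (r n) * w (Suc n) = of_real (r n) * v (Suc n) - x (Suc n) * cnj (of_real (r n) * v (Suc n))"
      by (simp add: w_def algebra_simps)
    also have "\<dots> = w n + x (Suc n) * cnj (a n) * v n"
      unfolding vS w_def xS[of n] by (simp add: algebra_simps)
    finally show ?thesis .
  qed
  have "x \<longlonglongrightarrow> 0"
  proof -
    have "(\<lambda>n. \<Sum>j. a (j + n)) \<longlonglongrightarrow> 0"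
      using suminf_exist_split2[of a] su by (simp add: a_def[abs_def])
    then show ?thesis by (simp add: a_def[abs_def] x_def)
  qed
  then have "eventually (\<lambda>n. cmod (x n) < 1/2) sequentially"
    by (auto dest!: tendstoD[of _ _ _ "1/2"])
  moreover have "eventually (\<lambda>n. (cmod (\<alpha> n))\<^sup>2 < 1/2) sequentially"
    by (rule order_tendstoD(2)[OF summable_LIMSEQ_zero[OF sq]]) simp
  ultimately have "eventually (\<lambda>n. cmod (x n) < 1/2 \<and> (cmod (\<alpha> n))\<^sup>2 < 1/2) sequentially"
    by eventually_elim simp
  then obtain m where m: "\<And>n. n \<ge> m \<Longrightarrow> cmod (x n) < 1/2" "\<And>n. n \<ge> m \<Longrightarrow> (cmod (\<alpha> n))\<^sup>2 < 1/2"
    unfolding eventually_sequentially by blast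
  \<comment> \<open>Once \<open>x n\<close> is below 1/2 in modulus, the change of variables can be
    undone at the cost of a factor 2.\<close>
  have vw: "cmod (v n) \<le> 2 * cmod (w n)" if "n \<ge> m" for n
  proof -
    have "cmod (v n) - cmod (x n) * cmod (v n) \<le> cmod (w n)"
      unfolding w_def using norm_triangle_ineq2[of "v n" "x n * cnj (v n)"] by (simp add: norm_mult)
    moreover have "cmod (x n) * cmod (v n) \<le> 1/2 * cmod (v n)"
      using m(1)[OF that] by (intro mult_right_mono) auto
    ultimately show ?thesis by simp
  qed
  define c where "c n = 2 * (cmod (\<alpha> n) * cmod (x (Suc n))) + (cmod (\<alpha> n))\<^sup>2" for n
  have "Bseq (\<lambda>n. cmod (w n))"
  proof (rule Bseq_if_growth_summable[of m _ c])
    fix n assume n: "n \<ge> m"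
    have "r n * cmod (w (Suc n)) = cmod (w n + x (Suc n) * cnj (a n) * v n)"
      using r[of n] unfolding wS[symmetric] by (simp add: norm_mult)
    also have "\<dots> \<le> cmod (w n) + cmod (x (Suc n)) * cmod (\<alpha> n) * cmod (v n)"
      by (rule order_trans[OF norm_triangle_ineq]) (simp add: norm_mult na)
    also have "\<dots> \<le> cmod (w n) + cmod (x (Suc n)) * cmod (\<alpha> n) * (2 * cmod (w n))"
      using vw[OF n] by (intro add_left_mono mult_left_mono) auto
    also have "\<dots> = cmod (w n) * (1 + 2 * (cmod (\<alpha> n) * cmod (x (Suc n))))" by (simp add: algebra_simps)
    also have "\<dots> \<le> cmod (w n) * exp (2 * (cmod (\<alpha> n) * cmod (x (Suc n))))"
      by (intro mult_left_mono exp_ge_add_one_self) auto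
    finally have "cmod (w (Suc n)) \<le> cmod (w n) * exp (2 * (cmod (\<alpha> n) * cmod (x (Suc n)))) * (1 / r n)"
      using r[of n] by (simp add: field_simps)
    also have "\<dots> \<le> cmod (w n) * exp (2 * (cmod (\<alpha> n) * cmod (x (Suc n)))) * exp ((cmod (\<alpha> n))\<^sup>2)"
      unfolding r_def using m(2)[OF n] by (intro mult_left_mono exp_le_inverse_sqrt) auto
    finally show "cmod (w (Suc n)) \<le> cmod (w n) * exp (c n)"
      by (simp add: c_def exp_add mult.assoc)
  qed (use pr sq in \<open>auto simp: c_def[abs_def] intro!: summable_add summable_mult\<close>)
  then obtain K where K: "\<And>n. cmod (w n) \<le> K" by (auto simp: Bseq_def)
  have "Bseq (\<lambda>n. v (n + m))"
    using vw K by (intro BseqI'[of _ "2 * K"]) (smt (verit) le_add2)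
  then have "Bseq v" by (rule Bseq_offset)
  moreover have "norm (f n) = norm (v n)" for n by (simp add: v_def norm_mult norm_power z)
  ultimately show ?thesis unfolding Bseq_def f_def by simp
qed

section \<open>The Rademacher-Menshov inequality at roots of unity\<close>

lemma sum_roots_unity_power:
  fixes a b M :: nat
  assumes "M > 0" "a < M" "b < M"
  shows "(\<Sum>i<M. cis (2 * pi * real i / real M) ^ a * cnj (cis (2 * pi * real i / real M) ^ b)) =
    (if a = b then of_nat M else 0)"
proof -
  define q where "q = cis (2 * pi * (real a - real b) / real M)"
  have *: "cis (2 * pi * real i / real M) ^ a * cnj (cis (2 * pi * real i / real M) ^ b) = q ^ i" for i
    unfolding q_def
    by (simp add: Complex.DeMoivre cis_cnj cis_mult) (simp add: algebra_simps diff_divide_distrib)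
  show ?thesis
  proof (cases "a = b")
    case True
    then have "q = 1" by (simp add: q_def)
    then show ?thesis unfolding * using True by simp
  next
    case False
    have "q \<noteq> 1"
    proof
      assume "q = 1"
      then have "cos (2 * pi * (real a - real b) / real M) = 1"
        by (simp add: q_def complex_eq_iff)
      then obtain k :: int where "2 * pi * (real a - real b) / real M = of_int k * 2 * pi"
        using cos_one_2pi_int by auto
      then have "2 * pi * (real a - real b) = 2 * pi * (of_int k * real M)"
        using assms(1) by (subst (asm) nonzero_divide_eq_eq) simp_all
      then have "real a - real b = of_int k * real M" by (subst (asm) mult_left_cancel) simp_all
      then have e: "int a - int b = k * int M"
        by (metis (mono_tags, opaque_lifting) of_int_diff of_int_eq_iff of_int_mult of_int_of_nat_eq)
      then have "k \<noteq> 0" using False by auto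
      then have "int M \<le> \<bar>k * int M\<bar>"
        using assms(1) by (simp add: abs_mult)
      then show False using e assms by linarith
    qed
    moreover have "q ^ M = 1"
    proof -
      have "q ^ M = cis (of_int (int a - int b) * (2 * pi))"
        using assms(1) by (simp add: q_def Complex.DeMoivre mult_ac)
      also have "\<dots> = 1"
        by (metis cis_multiple_2pi Ints_of_int mult.commute)
      finally show ?thesis .
    qed
    ultimately show ?thesis
      unfolding * using False by (simp add: sum_gp_strict)
  qed
qed

text \<open>The indices in \<open>I\<close> are distinct modulo \<open>M\<close>, so the powers are
  exactly orthogonal on the grid. Writing them as \<open>s + a\<close> with \<open>a < M\<close>
  splits off a unimodular factor and leaves the residues.\<close>

lemma parseval_roots_unity:
  fixes c :: "nat \<Rightarrow> complex" and I :: "nat set"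
  assumes "I \<subseteq> {s..<s + M}"
  shows "(\<Sum>i<M. (cmod (\<Sum>j\<in>I. c j * cis (2 * pi * real i / real M) ^ j))\<^sup>2) =
    real M * (\<Sum>j\<in>I. (cmod (c j))\<^sup>2)"
proof (cases "M = 0")
  case True
  with assms show ?thesis by simp
next
  case False
  define g where "g i = cis (2 * pi * real i / real M)" for i
  have fin: "finite I" using assms finite_subset by blast
  have g1: "g i ^ s * cnj (g i ^ s) = 1" for i
    by (simp add: g_def flip: complex_norm_square power_mult_distrib)
  have "complex_of_real (\<Sum>i<M. (cmod (\<Sum>j\<in>I. c j * g i ^ j))\<^sup>2) =
      (\<Sum>i<M. (\<Sum>j\<in>I. c j * g i ^ j) * cnj (\<Sum>j\<in>I. c j * g i ^ j))"
    by (simp only: complex_norm_square of_real_sum)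
  also have "\<dots> = (\<Sum>i<M. \<Sum>j\<in>I. \<Sum>l\<in>I. c j * cnj (c l) * (g i ^ j * cnj (g i ^ l)))"
    by (simp only: cnj_sum sum_product complex_cnj_mult mult_ac)
  also have "\<dots> = (\<Sum>j\<in>I. \<Sum>l\<in>I. c j * cnj (c l) * (\<Sum>i<M. g i ^ j * cnj (g i ^ l)))"
    by (subst sum.swap, rule sum.cong[OF refl], subst sum.swap) (simp add: sum_distrib_left)
  also have "\<dots> = (\<Sum>j\<in>I. \<Sum>l\<in>I. c j * cnj (c l) * (if j = l then of_nat M else 0))"
  proof (intro sum.cong refl arg_cong2[of _ _ _ _ "(*)"])
    fix j l assume "j \<in> I" "l \<in> I"
    then obtain a b where ab: "j = s + a" "l = s + b" "a < M" "b < M"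
      using assms by (metis atLeastLessThan_iff le_Suc_ex nat_add_left_cancel_less subsetD)
    have "g i ^ j * cnj (g i ^ l) = (g i ^ s * cnj (g i ^ s)) * (g i ^ a * cnj (g i ^ b))" for i
      by (simp add: ab power_add algebra_simps)
    then have "g i ^ j * cnj (g i ^ l) = g i ^ a * cnj (g i ^ b)" for i
      using g1 by simp
    then show "(\<Sum>i<M. g i ^ j * cnj (g i ^ l)) = (if j = l then of_nat M else 0)"
      using sum_roots_unity_power[of M a b] ab False by (simp add: g_def)
  qed
  also have "\<dots> = (\<Sum>j\<in>I. \<Sum>l\<in>I. if j = l then c j * cnj (c l) * of_nat M else 0)"
    by (intro sum.cong refl) simp
  also have "\<dots> = (\<Sum>j\<in>I. c j * cnj (c j) * of_nat M)"
    using fin by (simp add: sum.delta)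
  also have "\<dots> = complex_of_real (real M * (\<Sum>j\<in>I. (cmod (c j))\<^sup>2))"
    by (simp only: complex_norm_square of_real_sum of_real_mult sum_distrib_left of_real_of_nat_eq mult_ac)
  finally show ?thesis unfolding g_def of_real_eq_iff .
qed

text \<open>Lets the two halves of a block enter the maximal inequality in quadrature, so that their
  energies add.\<close>

lemma L2_set_sqrt_add:
  "L2_set (\<lambda>i. sqrt ((f i)\<^sup>2 + (g i)\<^sup>2)) A = sqrt ((L2_set f A)\<^sup>2 + (L2_set g A)\<^sup>2)"
  by (simp add: L2_set_def sum.distrib sum_nonneg)

text \<open>The Rademacher-Menshov maximal inequality on the grid of roots of unity. The maximum over the
  length of the partial sum is expressed by a choice function \<open>m\<close>.\<close>
lemma rademacher_menshov_roots_unity: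
  fixes c :: "nat \<Rightarrow> complex"
  assumes "\<And>i. i < M \<Longrightarrow> a \<le> m i \<and> m i \<le> a + 2 ^ k" "s \<le> a" "a + 2 ^ k \<le> s + M"
  shows "L2_set (\<lambda>i. cmod (\<Sum>j\<in>{a..<m i}. c j * cis (2 * pi * real i / real M) ^ j)) {..<M}
     \<le> (real k + 1) * sqrt (real M * (\<Sum>j\<in>{a..<a + 2 ^ k}. (cmod (c j))\<^sup>2))"
  using assms
proof (induction k arbitrary: a m)
  case 0
  have "L2_set (\<lambda>i. cmod (\<Sum>j\<in>{a..<m i}. c j * cis (2 * pi * real i / real M) ^ j)) {..<M}
      \<le> L2_set (\<lambda>i. cmod (\<Sum>j\<in>{a..<a + 1}. c j * cis (2 * pi * real i / real M) ^ j)) {..<M}"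
  proof (rule L2_set_mono)
    fix i assume "i \<in> {..<M}"
    then have "m i = a \<or> m i = a + 1" using 0(1)[of i] by auto
    then show "cmod (\<Sum>j\<in>{a..<m i}. c j * cis (2 * pi * real i / real M) ^ j)
      \<le> cmod (\<Sum>j\<in>{a..<a + 1}. c j * cis (2 * pi * real i / real M) ^ j)" by auto
  qed auto
  also have "\<dots> = sqrt (real M * (\<Sum>j\<in>{a..<a + 1}. (cmod (c j))\<^sup>2))"
    unfolding L2_set_def using 0 by (subst parseval_roots_unity[of _ s]) auto
  finally show ?case by simp
next
  case (Suc k)
  let ?g = "\<lambda>i. cis (2 * pi * real i / real M)"
  let ?S = "\<lambda>A i. \<Sum>j\<in>A. c j * ?g i ^ j"
  let ?E = "\<lambda>A. real M * (\<Sum>j\<in>A. (cmod (c j))\<^sup>2)"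
  define b where "b = a + 2 ^ k"
  \<comment> \<open>Clipping at the midpoint: if \<open>m i \<le> b\<close>, the right partial sum
    is empty; otherwise the left one is the whole left half, an overcount that only weakens the
    bound.\<close>
  define m1 where "m1 i = min (m i) b" for i
  define m2 where "m2 i = max (m i) b" for i
  have b2: "b + 2 ^ k = a + 2 ^ Suc k" by (simp add: b_def)
  have sub: "{a..<b} \<subseteq> {s..<s + M}" using Suc(3,4) by (auto simp: b_def)
  have pw: "cmod (?S {a..<m i} i) \<le> cmod (?S {a..<b} i) +
      sqrt ((cmod (?S {a..<m1 i} i))\<^sup>2 + (cmod (?S {b..<m2 i} i))\<^sup>2)" if "i < M" for i
  proof (cases "m i \<le> b")
    case True
    then have "m1 i = m i" "m2 i = b" by (auto simp: m1_def m2_def)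
    then show ?thesis by simp
  next
    case False
    then have "m2 i = m i" by (auto simp: m2_def)
    have "?S {a..<m i} i = ?S {a..<b} i + ?S {b..<m i} i"
      using False by (subst sum.atLeastLessThan_concat) (auto simp: b_def)
    then have "cmod (?S {a..<m i} i) \<le> cmod (?S {a..<b} i) + cmod (?S {b..<m2 i} i)"
      by (simp only: \<open>m2 i = m i\<close> norm_triangle_ineq)
    moreover have "cmod (?S {b..<m2 i} i) \<le> sqrt ((cmod (?S {a..<m1 i} i))\<^sup>2 + (cmod (?S {b..<m2 i} i))\<^sup>2)"
      by (rule real_sqrt_sum_squares_ge2)
    ultimately show ?thesis by linarith
  qed
  have IH1: "L2_set (\<lambda>i. cmod (?S {a..<m1 i} i)) {..<M} \<le> (real k + 1) * sqrt (?E {a..<b})"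
    unfolding b_def using Suc.prems by (intro Suc.IH) (auto simp: m1_def b_def min_def)
  have IH2: "L2_set (\<lambda>i. cmod (?S {b..<m2 i} i)) {..<M} \<le> (real k + 1) * sqrt (?E {b..<a + 2 ^ Suc k})"
    unfolding b2[symmetric]
  proof (rule Suc.IH)
    show "b \<le> m2 i \<and> m2 i \<le> b + 2 ^ k" if "i < M" for i
      using Suc.prems(1)[OF that] b2 by (simp add: m2_def)
  qed (use Suc.prems b2 in \<open>auto simp: b_def\<close>)
  define X where "X = L2_set (\<lambda>i. cmod (?S {a..<m1 i} i)) {..<M}"
  define Y where "Y = L2_set (\<lambda>i. cmod (?S {b..<m2 i} i)) {..<M}"
  define E where "E = ?E {a..<a + 2 ^ Suc k}"
  define E1 where "E1 = ?E {a..<b}"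
  define E2 where "E2 = ?E {b..<a + 2 ^ Suc k}"
  have E: "E = E1 + E2" "E1 \<ge> 0" "E2 \<ge> 0"
    unfolding E_def E1_def E2_def distrib_left[symmetric]
    by (subst sum.atLeastLessThan_concat) (auto simp: b_def intro!: mult_nonneg_nonneg sum_nonneg)
  have "L2_set (\<lambda>i. cmod (?S {a..<m i} i)) {..<M} \<le> L2_set (\<lambda>i. cmod (?S {a..<b} i) +
      sqrt ((cmod (?S {a..<m1 i} i))\<^sup>2 + (cmod (?S {b..<m2 i} i))\<^sup>2)) {..<M}"
    by (rule L2_set_mono) (simp_all only: lessThan_iff pw norm_ge_zero)
  moreover have "\<dots> \<le> L2_set (\<lambda>i. cmod (?S {a..<b} i)) {..<M} + sqrt (X\<^sup>2 + Y\<^sup>2)"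
    unfolding X_def Y_def L2_set_sqrt_add[symmetric] by (rule L2_set_triangle_ineq)
  moreover have "L2_set (\<lambda>i. cmod (?S {a..<b} i)) {..<M} = sqrt E1"
    unfolding L2_set_def E1_def by (subst parseval_roots_unity[OF sub]) (rule refl)
  moreover have "sqrt E1 \<le> sqrt E" using E by simp
  \<comment> \<open>The same constant serves both halves, so \<open>E1\<close> and \<open>E2\<close>
    recombine to \<open>E\<close>. The separate term \<open>sqrt E1\<close> is the price of one
    level, whence the linear growth in \<open>k\<close>.\<close>
  moreover have "sqrt (X\<^sup>2 + Y\<^sup>2) \<le> (real k + 1) * sqrt E"
  proof -
    have "0 \<le> X" "0 \<le> Y" unfolding X_def Y_def by (rule L2_set_nonneg)+
    then have "X\<^sup>2 + Y\<^sup>2 \<le> ((real k + 1) * sqrt E1)\<^sup>2 + ((real k + 1) * sqrt E2)\<^sup>2"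
      using IH1 IH2 unfolding X_def[symmetric] Y_def[symmetric] E1_def[symmetric] E2_def[symmetric]
      by (intro add_mono power_mono) auto
    also have "\<dots> = (real k + 1)\<^sup>2 * E"
      using E by (simp add: power_mult_distrib distrib_left)
    finally have "sqrt (X\<^sup>2 + Y\<^sup>2) \<le> sqrt ((real k + 1)\<^sup>2 * E)" by simp
    then show ?thesis by (simp add: real_sqrt_mult)
  qed
  moreover have "(real (Suc k) + 1) * sqrt E = sqrt E + (real k + 1) * sqrt E"
    by (simp add: algebra_simps)
  ultimately show ?case unfolding E_def[symmetric] by linarith
qed

text \<open>Abel summation. If \<open>cmod (w - 1)\<close> is of order \<open>1 / (m - a)\<close>,
  the loss is a bounded factor, so one grid point controls a whole arc.\<close>

lemma norm_sum_power_move: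
  fixes c :: "nat \<Rightarrow> complex" and u w :: complex
  assumes w: "cmod w = 1" and D: "\<And>n. a \<le> n \<Longrightarrow> n \<le> m \<Longrightarrow> cmod (\<Sum>j\<in>{a..<n}. c j * u ^ j) \<le> D"
    and "a \<le> m"
  shows "cmod (\<Sum>j\<in>{a..<m}. c j * (u * w) ^ j) \<le> D * (1 + real (m - a) * cmod (w - 1))"
proof -
  define S where "S n = (\<Sum>j\<in>{a..<n}. c j * u ^ j)" for n
  have "(\<Sum>j\<in>{a..<m}. c j * (u * w) ^ j) = S m * w ^ m - (\<Sum>j\<in>{a..<m}. S (Suc j) * (w ^ Suc j - w ^ j))"
    using \<open>a \<le> m\<close>
  proof (induction m rule: dec_induct)
    case base
    show ?case by (simp add: S_def)
  next
    case (step n)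
    have "S (Suc n) = S n + c n * u ^ n" using step by (simp add: S_def)
    then show ?case using step by (simp add: algebra_simps power_mult_distrib)
  qed
  also have "cmod \<dots> \<le> cmod (S m * w ^ m) + cmod (\<Sum>j\<in>{a..<m}. S (Suc j) * (w ^ Suc j - w ^ j))"
    by (rule norm_triangle_ineq4)
  also have "\<dots> \<le> D + (\<Sum>j\<in>{a..<m}. D * cmod (w - 1))"
  proof (rule add_mono)
    show "cmod (S m * w ^ m) \<le> D" using D[of m] assms by (simp add: S_def norm_mult norm_power)
    show "cmod (\<Sum>j\<in>{a..<m}. S (Suc j) * (w ^ Suc j - w ^ j)) \<le> (\<Sum>j\<in>{a..<m}. D * cmod (w - 1))"
    proof (rule sum_norm_le)
      fix j assume j: "j \<in> {a..<m}"
      have "w ^ Suc j - w ^ j = w ^ j * (w - 1)" by (simp add: algebra_simps)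
      then have "cmod (S (Suc j) * (w ^ Suc j - w ^ j)) = cmod (S (Suc j)) * cmod (w - 1)"
        by (simp add: norm_mult norm_power w)
      also have "\<dots> \<le> D * cmod (w - 1)" using D[of "Suc j"] j by (intro mult_right_mono) (auto simp: S_def)
      finally show "cmod (S (Suc j) * (w ^ Suc j - w ^ j)) \<le> D * cmod (w - 1)" .
    qed
  qed
  finally show ?thesis by (simp add: algebra_simps)
qed

section \<open>Dyadic blocks\<close>

text \<open>Chains the blocks between \<open>2 ^ k\<close> and \<open>n\<close>; their bounds form a
  geometric series, so the result is uniform in \<open>n\<close>.\<close>

lemma norm_sum_dyadic_le:
  fixes f :: "nat \<Rightarrow> complex"
  assumes q: "0 < q" "q < 1" and k: "k0 \<le> k" "2 ^ k \<le> n"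
    and f: "\<And>k n. k0 \<le> k \<Longrightarrow> 2 ^ k \<le> n \<Longrightarrow> n \<le> 2 ^ Suc k \<Longrightarrow> cmod (sum f {2 ^ k..<n}) \<le> K * q ^ k"
  shows "cmod (sum f {2 ^ k..<n}) \<le> K / (1 - q) * q ^ k"
proof -
  \<comment> \<open>At \<open>n = 2 ^ k0\<close> the sum is empty, so the hypothesis itself forces
    \<open>K\<close> to be nonnegative.\<close>
  have K: "0 \<le> K"
    using f[of k0 "2 ^ k0"] zero_less_power[OF q(1), of k0] by (auto simp: zero_le_mult_iff)
  have *: "cmod (sum f {2 ^ k..<n}) \<le> (\<Sum>i<d. K * q ^ (k + i))" if "2 ^ k \<le> n" "n \<le> 2 ^ (k + d)" for d n
    using that
  proof (induction d arbitrary: n)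
    case (Suc d)
    show ?case
    proof (cases "n \<le> 2 ^ (k + d)")
      case True
      have "0 \<le> K * q ^ (k + d)" using K q by simp
      then show ?thesis using Suc.IH[OF Suc.prems(1) True] by simp
    next
      case False
      have "(2::nat) ^ k \<le> 2 ^ (k + d)" by (rule power_increasing) auto
      then have "sum f {2 ^ k..<n} = sum f {2 ^ k..<2 ^ (k + d)} + sum f {2 ^ (k + d)..<n}"
        using False by (subst sum.atLeastLessThan_concat) auto
      moreover have "cmod (sum f {2 ^ k..<2 ^ (k + d)}) \<le> (\<Sum>i<d. K * q ^ (k + i))"
        by (rule Suc.IH) (auto intro: power_increasing)
      moreover have "cmod (sum f {2 ^ (k + d)..<n}) \<le> K * q ^ (k + d)"
        using False Suc.prems k by (intro f) auto
      ultimately show ?thesis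
        using norm_triangle_ineq[of "sum f {2 ^ k..<2 ^ (k + d)}" "sum f {2 ^ (k + d)..<n}"] by simp
    qed
  qed simp
  have "n \<le> 2 ^ (k + n)"
    by (metis less_exp le_add2 less_imp_le order_trans power_increasing_iff one_less_numeral_iff semiring_norm(76))
  then have "cmod (sum f {2 ^ k..<n}) \<le> (\<Sum>i<n. K * q ^ (k + i))" using * k by blast
  also have "\<dots> = K * q ^ k * (\<Sum>i<n. q ^ i)" by (simp add: sum_distrib_left power_add mult_ac)
  also have "\<dots> \<le> K * q ^ k * (1 / (1 - q))"
  proof (rule mult_left_mono)
    show "(\<Sum>i<n. q ^ i) \<le> 1 / (1 - q)"
      using q by (simp add: sum_gp_strict divide_right_mono)
  qed (use K q in simp)
  finally show ?thesis by simp
qed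

text \<open>A tail may start at a non-dyadic \<open>m\<close>: a sum from \<open>m\<close> is a
  difference of two sums from \<open>2 ^ k\<close>, whence the factor 2.\<close>

lemma dyadic_tail_bound:
  fixes f :: "nat \<Rightarrow> complex"
  assumes q: "0 < q" "q < 1"
    and f: "\<And>k n. k0 \<le> k \<Longrightarrow> 2 ^ k \<le> n \<Longrightarrow> n \<le> 2 ^ Suc k \<Longrightarrow> cmod (sum f {2 ^ k..<n}) \<le> K * q ^ k"
  shows "summable f"
    and "k0 \<le> k \<Longrightarrow> 2 ^ k \<le> m \<Longrightarrow> cmod (\<Sum>j. f (j + m)) \<le> 2 * K / (1 - q) * q ^ k"
proof -
  have *: "cmod (sum f {m..<n}) \<le> 2 * K / (1 - q) * q ^ k" if "k0 \<le> k" "2 ^ k \<le> m" for k m n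
  proof (cases "m \<le> n")
    case True
    then have "sum f {m..<n} = sum f {2 ^ k..<n} - sum f {2 ^ k..<m}"
      using that sum.atLeastLessThan_concat[of "2 ^ k" m n f] by (simp add: algebra_simps)
    then have "cmod (sum f {m..<n}) \<le> cmod (sum f {2 ^ k..<n}) + cmod (sum f {2 ^ k..<m})"
      by (simp only: norm_triangle_ineq4)
    also have "\<dots> \<le> K / (1 - q) * q ^ k + K / (1 - q) * q ^ k"
      using that True by (intro add_mono norm_sum_dyadic_le[OF q _ _ f]) auto
    finally show ?thesis by simp
  next
    case False
    have "0 \<le> K / (1 - q) * q ^ k"
      by (rule order_trans[OF norm_ge_zero norm_sum_dyadic_le[OF q that f]])
    then show ?thesis using False by simp
  qed
  show sf: "summable f"
    unfolding summable_Cauchy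
  proof (intro allI impI)
    fix e :: real assume "e > 0"
    have "(\<lambda>k. 2 * K / (1 - q) * q ^ k) \<longlonglongrightarrow> 2 * K / (1 - q) * 0"
      using q by (intro tendsto_mult tendsto_const LIMSEQ_power_zero) auto
    then have "eventually (\<lambda>k. 2 * K / (1 - q) * q ^ k < e) sequentially"
      using \<open>e > 0\<close> by (intro order_tendstoD(2)) auto
    then obtain k1 where k1: "\<And>k. k \<ge> k1 \<Longrightarrow> 2 * K / (1 - q) * q ^ k < e"
      by (auto simp: eventually_sequentially)
    show "\<exists>N. \<forall>m\<ge>N. \<forall>n. cmod (sum f {m..<n}) < e"
    proof (intro exI[of _ "2 ^ (max k0 k1)"] allI impI)
      fix m n :: nat assume "2 ^ max k0 k1 \<le> m"
      then have "cmod (sum f {m..<n}) \<le> 2 * K / (1 - q) * q ^ max k0 k1" by (intro *) auto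
      also have "\<dots> < e" by (rule k1) auto
      finally show "cmod (sum f {m..<n}) < e" .
    qed
  qed
  assume k: "k0 \<le> k" "2 ^ k \<le> m"
  show "cmod (\<Sum>j. f (j + m)) \<le> 2 * K / (1 - q) * q ^ k"
  proof (rule Lim_bounded)
    show "(\<lambda>n. cmod (\<Sum>j<n. f (j + m))) \<longlonglongrightarrow> cmod (\<Sum>j. f (j + m))"
      using sf by (intro tendsto_norm summable_LIMSEQ summable_ignore_initial_segment)
    show "\<forall>n\<ge>0. cmod (\<Sum>j<n. f (j + m)) \<le> 2 * K / (1 - q) * q ^ k"
    proof (intro allI impI)
      fix n
      have "(\<Sum>j<n. f (j + m)) = sum f {m..<n + m}"
        using sum.shift_bounds_nat_ivl[of f 0 m n] by (simp add: atLeast0LessThan)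
      then show "cmod (\<Sum>j<n. f (j + m)) \<le> 2 * K / (1 - q) * q ^ k" using *[OF k] by simp
    qed
  qed
qed

lemma summable_dyadic:
  fixes h :: "nat \<Rightarrow> real"
  assumes q: "0 < q" "q < 1" and h: "\<And>n. 0 \<le> h n"
    and b: "\<And>k. k0 \<le> k \<Longrightarrow> sum h {2 ^ k..<2 ^ Suc k} \<le> K * q ^ k"
  shows "summable h"
proof -
  have "summable (\<lambda>j. complex_of_real (h j))"
  proof (rule dyadic_tail_bound(1)[OF q])
    fix k n :: nat assume k: "k0 \<le> k" "2 ^ k \<le> n" "n \<le> 2 ^ Suc k"
    have "cmod (\<Sum>j\<in>{2 ^ k..<n}. complex_of_real (h j)) = sum h {2 ^ k..<n}"
      using h by (simp flip: of_real_sum add: sum_nonneg)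
    also have "\<dots> \<le> sum h {2 ^ k..<2 ^ Suc k}"
      using k h by (intro sum_mono2) auto
    also have "\<dots> \<le> K * q ^ k" by (rule b[OF k(1)])
    finally show "cmod (\<Sum>j\<in>{2 ^ k..<n}. complex_of_real (h j)) \<le> K * q ^ k" .
  qed
  then show ?thesis by (simp add: summable_of_real_iff)
qed

text \<open>Here \<open>p\<close> is the decay of the block energies and \<open>q\<close> that of
  the block sums. Cauchy-Schwarz over the \<open>2 ^ k\<close> indices of a block bounds its share
  of the Harris-Lutz series by a multiple of \<open>(q * sqrt (2 * p)) ^ k\<close>, which explains
  the condition on \<open>2 * p * q\<^sup>2\<close>.\<close>

lemma Bseq_szego_rec_dyadic:
  assumes z: "cmod z = 1" and \<alpha>: "\<And>n. cmod (\<alpha> n) < 1"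
    and pq: "0 < p" "p < 1" "0 < q" "q < 1" "2 * p * q\<^sup>2 < 1"
    and E: "\<And>k. (\<Sum>j\<in>{2 ^ k..<2 ^ Suc k}. (cmod (\<alpha> j))\<^sup>2) \<le> C * p ^ k"
    and S: "\<And>k n. k0 \<le> k \<Longrightarrow> 2 ^ k \<le> n \<Longrightarrow> n \<le> 2 ^ Suc k \<Longrightarrow>
      cmod (\<Sum>j\<in>{2 ^ k..<n}. \<alpha> j * z ^ j) \<le> K * q ^ k"
  shows "Bseq (szego_rec \<alpha> z)"
proof (rule Bseq_szego_rec[OF z \<alpha>])
  have C: "0 \<le> C" using order_trans[OF sum_nonneg E[of 0]] by simp
  show "summable (\<lambda>n. (cmod (\<alpha> n))\<^sup>2)"
    using pq E by (intro summable_dyadic[of p _ 0 C]) auto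
  have S': "cmod (\<Sum>j\<in>{2 ^ k..<n}. \<alpha> j * z ^ (j + 1)) \<le> K * q ^ k"
    if "k0 \<le> k" "2 ^ k \<le> n" "n \<le> 2 ^ Suc k" for k n
  proof -
    have "(\<Sum>j\<in>{2 ^ k..<n}. \<alpha> j * z ^ (j + 1)) = z * (\<Sum>j\<in>{2 ^ k..<n}. \<alpha> j * z ^ j)"
      by (simp add: sum_distrib_left mult_ac)
    then show ?thesis using S[OF that] by (simp add: norm_mult z)
  qed
  note tb = dyadic_tail_bound[OF pq(3,4), of k0 "\<lambda>j. \<alpha> j * z ^ (j + 1)" K, OF S']
  show "summable (\<lambda>n. \<alpha> n * z ^ (n + 1))" using tb(1) by simp
  have K: "0 \<le> K"
    using S[of k0 "2 ^ k0"] zero_less_power[OF pq(3), of k0] by (auto simp: zero_le_mult_iff)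
  define L where "L = 2 * K / (1 - q)"
  define r where "r = q * sqrt (2 * p)"
  have "r\<^sup>2 < 1\<^sup>2" using pq by (simp add: r_def power_mult_distrib mult_ac)
  then have r: "0 < r" "r < 1" using pq power2_less_imp_less[of r 1] by (auto simp: r_def)
  show "summable (\<lambda>n. cmod (\<alpha> n) * cmod (\<Sum>j. \<alpha> (j + Suc n) * z ^ (j + Suc n + 1)))"
  proof (rule summable_dyadic[OF r, of _ k0 "L * sqrt C"])
    fix k assume k: "k0 \<le> k"
    have "(\<Sum>n\<in>{2 ^ k..<2 ^ Suc k}. cmod (\<alpha> n) * cmod (\<Sum>j. \<alpha> (j + Suc n) * z ^ (j + Suc n + 1)))
       \<le> (\<Sum>n\<in>{2 ^ k..<2 ^ Suc k}. \<bar>cmod (\<alpha> n)\<bar> * \<bar>L * q ^ k\<bar>)"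
    proof (intro sum_mono mult_mono)
      fix n assume "n \<in> {(2::nat) ^ k..<2 ^ Suc k}"
      then have "cmod (\<Sum>j. \<alpha> (j + Suc n) * z ^ (j + Suc n + 1)) \<le> L * q ^ k"
        unfolding L_def by (intro tb(2)[OF _ _ _ k]) auto
      then show "cmod (\<Sum>j. \<alpha> (j + Suc n) * z ^ (j + Suc n + 1)) \<le> \<bar>L * q ^ k\<bar>" by linarith
    qed auto
    also have "\<dots> \<le> L2_set (\<lambda>n. cmod (\<alpha> n)) {2 ^ k..<2 ^ Suc k} * L2_set (\<lambda>n::nat. L * q ^ k) {2 ^ k..<2 ^ Suc k}"
      by (rule L2_set_mult_ineq)
    also have "\<dots> \<le> sqrt (C * p ^ k) * (sqrt (2 ^ k) * (L * q ^ k))"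
    proof (rule mult_mono)
      show "L2_set (\<lambda>n. cmod (\<alpha> n)) {2 ^ k..<2 ^ Suc k} \<le> sqrt (C * p ^ k)"
        unfolding L2_set_def using E[of k] by simp
      have "L2_set (\<lambda>n::nat. L * q ^ k) {2 ^ k..<2 ^ Suc k} = sqrt (2 ^ k) * \<bar>L * q ^ k\<bar>"
        unfolding L2_set_def by (simp add: real_sqrt_mult)
      then show "L2_set (\<lambda>n::nat. L * q ^ k) {2 ^ k..<2 ^ Suc k} \<le> sqrt (2 ^ k) * (L * q ^ k)"
        using K pq by (simp add: L_def)
    qed (use C pq in \<open>auto intro: L2_set_nonneg\<close>)
    also have "\<dots> = L * sqrt C * r ^ k"
      by (simp add: r_def real_sqrt_mult power_mult_distrib real_sqrt_power[symmetric] mult_ac)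
    finally show "(\<Sum>n\<in>{2 ^ k..<2 ^ Suc k}. cmod (\<alpha> n) * cmod (\<Sum>j. \<alpha> (j + Suc n) * z ^ (j + Suc n + 1)))
       \<le> L * sqrt C * r ^ k" .
  qed auto
qed

section \<open>Hausdorff measure of limsup sets\<close>

lemma diam_powr_empty [simp]: "diam_powr s {} = 0"
  by (simp add: diam_powr_def)

lemma diam_powr_nonneg: "0 \<le> diam_powr s U"
  by (simp add: diam_powr_def)

text \<open>Borel-Cantelli for Hausdorff measure: each late tail of the convergent series is the
  cost of an admissible cover.\<close>

lemma hausdorff_measure_limsup_zero:
  fixes U :: "nat \<Rightarrow> nat \<Rightarrow> 'a::metric_space set" and B :: "nat \<Rightarrow> nat set"
  assumes bd: "\<And>k i. i \<in> B k \<Longrightarrow> bounded (U k i)" and fin: "\<And>k. finite (B k)"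
    and dm: "\<And>k i. i \<in> B k \<Longrightarrow> diameter (U k i) \<le> d k" and d0: "d \<longlonglongrightarrow> 0"
    and sm: "summable (\<lambda>k. \<Sum>i\<in>B k. diam_powr s (U k i))"
    and cov: "\<And>k0. S \<subseteq> (\<Union>k\<in>{k0..}. \<Union>i\<in>B k. U k i)"
  shows "hausdorff_measure s S = 0"
proof -
  define t where "t k = (\<Sum>i\<in>B k. diam_powr s (U k i))" for k
  have t0: "0 \<le> t k" for k by (simp add: t_def sum_nonneg diam_powr_nonneg)
  have "hausdorff_premeasure s \<delta> S \<le> 0" if "\<delta> > 0" for \<delta>
  proof (rule ennreal_le_epsilon)
    fix e :: real assume "e > 0"
    have "eventually (\<lambda>k. d k < \<delta>) sequentially" using d0 that by (rule order_tendstoD(2))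
    then obtain k1 where k1: "\<And>k. k \<ge> k1 \<Longrightarrow> d k < \<delta>" by (auto simp: eventually_sequentially)
    obtain k2 where k2: "\<And>k. k \<ge> k2 \<Longrightarrow> norm (\<Sum>i. t (i + k)) < e"
      using suminf_exist_split[OF \<open>e > 0\<close> sm[folded t_def]] by blast
    define k0 where "k0 = max k1 k2"
    \<comment> \<open>A cover has to be a single sequence: the double family is padded with empty
      sets, which cost 0, and enumerated by \<open>prod_decode\<close>.\<close>
    define V where "V = (\<lambda>(k, i). if k \<ge> k0 \<and> i \<in> B k then U k i else {})"
    define t' where "t' k = (if k \<ge> k0 then t k else 0)" for k
    have st': "summable t'"
      by (rule summable_comparison_test'[OF sm[folded t_def], of 0]) (auto simp: t'_def t0)
    have "hausdorff_premeasure s \<delta> S \<le> (\<Sum>n. ennreal (diam_powr s ((V \<circ> prod_decode) n)))"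
      unfolding hausdorff_premeasure_def
    proof (rule INF_lower, safe)
      fix x assume "x \<in> S"
      then obtain k i where ki: "k \<ge> k0" "i \<in> B k" "x \<in> U k i" using cov[of k0] by auto
      then have "x \<in> (V \<circ> prod_decode) (prod_encode (k, i))" by (simp add: V_def)
      then show "x \<in> \<Union> (range (V \<circ> prod_decode))" by blast
    next
      fix n
      show "bounded ((V \<circ> prod_decode) n)" using bd by (auto simp: V_def split: prod.splits)
      show "diameter ((V \<circ> prod_decode) n) \<le> \<delta>"
        using dm k1 that by (force simp: V_def k0_def split: prod.splits)
    qed
    also have "\<dots> = (\<Sum>k. ennreal (t' k))"
      unfolding o_def
    proof (rule suminf_ennreal_2dimen)
      fix k
      have "(\<Sum>i. ennreal (diam_powr s (V (k, i)))) = (\<Sum>i\<in>B k. ennreal (diam_powr s (V (k, i))))"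
        by (rule suminf_finite[OF fin]) (auto simp: V_def)
      also have "\<dots> = ennreal (t' k)"
        by (auto simp: V_def t'_def t_def diam_powr_nonneg sum_nonneg)
      finally show "ennreal (t' k) = (\<Sum>i. ennreal (diam_powr s (V (k, i))))" by simp
    qed
    also have "\<dots> = ennreal (suminf t')"
    proof (rule suminf_ennreal2[OF _ st'])
      show "0 \<le> t' k" for k by (simp add: t'_def t0)
    qed
    also have "suminf t' = (\<Sum>i. t (i + k0))"
      using suminf_split_initial_segment[OF st', of k0] by (simp add: t'_def)
    also have "ennreal \<dots> \<le> ennreal e"
      using k2[of k0] by (intro ennreal_leI) (auto simp: k0_def)
    finally show "hausdorff_premeasure s \<delta> S \<le> 0 + ennreal e" by simp
  qed
  then have "hausdorff_measure s S \<le> 0" unfolding hausdorff_measure_def by (intro SUP_least) auto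
  then show ?thesis by simp
qed

lemma hausdorff_dim_le:
  assumes "0 \<le> d" "\<And>s. s > d \<Longrightarrow> hausdorff_measure s S = 0"
  shows "hausdorff_dim S \<le> ennreal d"
proof (rule ennreal_le_epsilon)
  fix e :: real assume "e > 0"
  have "hausdorff_dim S \<le> ennreal (d + e)"
    unfolding hausdorff_dim_def using assms \<open>e > 0\<close> by (intro INF_lower) auto
  then show "hausdorff_dim S \<le> ennreal d + ennreal e"
    using assms \<open>e > 0\<close> by (simp add: ennreal_plus)
qed

section \<open>Dimension of the exceptional set\<close>

lemma circle_eq_cis:
  assumes "cmod z = 1"
  obtains t where "0 \<le> t" "t < 2 * pi" "z = cis t"
proof (rule that[of "Arg2pi z"])
  show "z = cis (Arg2pi z)" using Arg2pi[of z] assms by (simp add: cis_conv_exp is_Arg_def)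
qed (use Arg2pi[of z] in auto)

lemma dist_cis_le: "dist (cis s) (cis t) \<le> \<bar>s - t\<bar>"
proof -
  have "cis s - cis t = cis t * (cis (s - t) - 1)" by (simp add: algebra_simps cis_mult)
  then have "dist (cis s) (cis t) = cmod (cis (s - t) - 1)" by (simp add: dist_norm norm_mult)
  also have "\<dots> = 2 * \<bar>sin ((s - t) / 2)\<bar>" by (simp only: cis_conv_exp dist_exp_i_1)
  also have "\<dots> \<le> \<bar>s - t\<bar>" using abs_sin_x_le_abs_x[of "(s - t) / 2"] by simp
  finally show ?thesis .
qed

lemma circle_grid_point:
  assumes "cmod z = 1" "M > 0"
  obtains i t where "i < M" "0 \<le> t" "t \<le> 2 * pi / real M" "z = cis (2 * pi * real i / real M) * cis t"
proof -
  obtain \<theta> where \<theta>: "0 \<le> \<theta>" "\<theta> < 2 * pi" "z = cis \<theta>"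
    using assms(1) by (rule circle_eq_cis)
  define y where "y = \<theta> * real M / (2 * pi)"
  define i where "i = nat \<lfloor>y\<rfloor>"
  have y: "0 \<le> y" "y < real M" using \<theta> assms by (auto simp: y_def field_simps)
  have i: "real i \<le> y" "y < real i + 1" using y by (auto simp: i_def)
  have e: "\<theta> = y * (2 * pi / real M)" using assms by (simp add: y_def)
  have w: "0 < 2 * pi / real M" using assms by simp
  show ?thesis
  proof (rule that[of i "(y - real i) * (2 * pi / real M)"])
    show "i < M" using i y by linarith
    show "0 \<le> (y - real i) * (2 * pi / real M)" using i w by (intro mult_nonneg_nonneg) auto
    show "(y - real i) * (2 * pi / real M) \<le> 2 * pi / real M"
      using mult_right_mono[of "y - real i" 1 "2 * pi / real M"] i w by simp
    show "z = cis (2 * pi * real i / real M) * cis ((y - real i) * (2 * pi / real M))"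
      unfolding \<theta>(3) cis_mult by (subst e) (simp add: algebra_simps diff_divide_distrib)
  qed
qed

lemma summable_square_geometric:
  fixes x :: real
  assumes "0 < x" "x < 1"
  shows "summable (\<lambda>k. (real k + 1)\<^sup>2 * x ^ k)"
proof -
  \<comment> \<open>With \<open>x = y ^ 4\<close>, one factor \<open>y ^ (2 * k)\<close> absorbs
    \<open>(real k + 1)\<^sup>2\<close> and the other is a convergent geometric series.\<close>
  define y where "y = sqrt (sqrt x)"
  have y: "0 < y" "y < 1" and xy: "x = y\<^sup>2 * y\<^sup>2" using assms by (auto simp: y_def)
  have "(\<lambda>n. real n * y ^ n) \<longlonglongrightarrow> 0"
    using powser_times_n_limit_0[of y] y by simp
  then have "Bseq (\<lambda>n. real n * y ^ n)" by (intro convergent_imp_Bseq) (auto simp: convergent_def)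
  then obtain K where K: "\<And>n. \<bar>real n * y ^ n\<bar> \<le> K" by (auto simp: Bseq_def)
  show ?thesis
  proof (rule summable_comparison_test')
    show "summable (\<lambda>k. (K + 1)\<^sup>2 * (y\<^sup>2) ^ k)"
      using y by (intro summable_mult summable_geometric) (simp add: power_less_one_iff abs_square_less_1)
    fix k
    have "(real k + 1) * y ^ k \<le> K + 1"
      using K[of k] power_le_one[of y k] y by (simp add: algebra_simps)
    then have "((real k + 1) * y ^ k)\<^sup>2 \<le> (K + 1)\<^sup>2"
      using y by (intro power_mono) auto
    then have "((real k + 1) * y ^ k)\<^sup>2 * (y\<^sup>2) ^ k \<le> (K + 1)\<^sup>2 * (y\<^sup>2) ^ k"
      by (intro mult_right_mono) auto
    moreover have "((real k + 1) * y ^ k)\<^sup>2 * (y\<^sup>2) ^ k = (real k + 1)\<^sup>2 * x ^ k"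
      unfolding xy by (simp add: power_mult_distrib power2_eq_square mult_ac)
    ultimately show "norm ((real k + 1)\<^sup>2 * x ^ k) \<le> (K + 1)\<^sup>2 * (y\<^sup>2) ^ k"
      using assms by simp
  qed
qed

text \<open>Chebyshev applied to the maximal inequality; the block fills exactly one window of
  \<open>2 ^ k\<close> frequencies, as many as there are grid points.\<close>

lemma card_large_partial_sums:
  fixes c :: "nat \<Rightarrow> complex" and k :: nat and D :: real
  defines "B \<equiv> {i. i < 2 ^ k \<and> (\<exists>n\<in>{2 ^ k..2 ^ Suc k}.
      D < cmod (\<Sum>j\<in>{2 ^ k..<n}. c j * cis (2 * pi * real i / real (2 ^ k)) ^ j))}"
  assumes "D \<ge> 0"
  shows "real (card B) * D\<^sup>2 \<le> (real k + 1)\<^sup>2 * (2 ^ k * (\<Sum>j\<in>{2 ^ k..<2 ^ Suc k}. (cmod (c j))\<^sup>2))"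
proof -
  define S where "S n i = (\<Sum>j\<in>{2 ^ k..<n}. c j * cis (2 * pi * real i / real (2 ^ k)) ^ j)" for n i
  \<comment> \<open>A witness of failure at the bad grid points; elsewhere \<open>2 ^ k\<close>,
    where the partial sum is empty.\<close>
  define m where "m i = (if i \<in> B then SOME n. n \<in> {2 ^ k..2 ^ Suc k} \<and> D < cmod (S n i) else 2 ^ k)" for i
  have m: "m i \<in> {2 ^ k..2 ^ Suc k} \<and> D < cmod (S (m i) i)" if "i \<in> B" for i
  proof -
    have "\<exists>n. n \<in> {2 ^ k..2 ^ Suc k} \<and> D < cmod (S n i)" using that by (auto simp: B_def S_def)
    from someI_ex[OF this] show ?thesis using that by (simp add: m_def)
  qed
  have finB: "finite B" by (rule finite_subset[of _ "{..<2 ^ k}"]) (auto simp: B_def)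
  have "real (card B) * D\<^sup>2 = (\<Sum>i\<in>B. D\<^sup>2)" by simp
  also have "\<dots> \<le> (\<Sum>i\<in>B. (cmod (S (m i) i))\<^sup>2)"
    using m assms(2) by (intro sum_mono power_mono) (auto intro: less_imp_le)
  also have "\<dots> \<le> (\<Sum>i<2 ^ k. (cmod (S (m i) i))\<^sup>2)"
    by (intro sum_mono2) (auto simp: B_def)
  also have "\<dots> = (L2_set (\<lambda>i. cmod (S (m i) i)) {..<2 ^ k})\<^sup>2"
    by (simp add: L2_set_def sum_nonneg)
  also have "\<dots> \<le> ((real k + 1) * sqrt (real (2 ^ k) * (\<Sum>j\<in>{2 ^ k..<2 ^ k + 2 ^ k}. (cmod (c j))\<^sup>2)))\<^sup>2"
    unfolding S_def
  proof (intro power_mono rademacher_menshov_roots_unity[of _ _ _ _ "2 ^ k"] L2_set_nonneg)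
    fix i :: nat
    show "2 ^ k \<le> m i \<and> m i \<le> 2 ^ k + 2 ^ k"
      using m[of i] by (cases "i \<in> B") (auto simp: m_def mult_2)
  qed auto
  also have "\<dots> = (real k + 1)\<^sup>2 * (2 ^ k * (\<Sum>j\<in>{2 ^ k..<2 ^ Suc k}. (cmod (c j))\<^sup>2))"
    by (simp add: power_mult_distrib sum_nonneg mult_2)
  finally show ?thesis .
qed

lemma hausdorff_measure_unbounded_szego_rec:
  fixes \<alpha> :: "nat \<Rightarrow> complex"
  assumes \<alpha>: "\<And>n. cmod (\<alpha> n) < 1" and \<eta>: "0 < \<eta>" "\<eta> < 1" and s: "s > 2 * (1 - \<eta>)"
    and E: "\<And>k. (\<Sum>j\<in>{2 ^ k..<2 ^ Suc k}. (cmod (\<alpha> j))\<^sup>2) \<le> C * (2 powr (- \<eta>)) ^ k"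
  shows "hausdorff_measure s
    {z \<in> sphere 0 1. \<not> (Bseq (szego_rec \<alpha> z) \<and> Bseq (szego_rec (\<lambda>n. - \<alpha> n) z))} = 0"
proof -
  define p where "p = 2 powr (- \<eta>)"
  define q where "q = 2 powr (- (s / 4))"
  define \<theta> where "\<theta> = 2 powr (1 - \<eta> - s / 2)"
  define g where "g k i = cis (2 * pi * real i / real (2 ^ k))" for k i :: nat
  define B where "B k = {i. i < 2 ^ k \<and> (\<exists>n\<in>{2 ^ k..2 ^ Suc k}.
      q ^ k < cmod (\<Sum>j\<in>{2 ^ k..<n}. \<alpha> j * g k i ^ j))}" for k
  have "2 * (1 - \<eta>) > 0" using \<eta> by simp
  then have s0: "s > 0" using s by (rule less_trans)
  have pq: "0 < p" "p < 1" "0 < q" "q < 1"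
    using \<eta> s0 powr_less_mono[of "- \<eta>" 0 2] powr_less_mono[of "- (s / 4)" 0 2]
    by (simp_all add: p_def q_def)
  have q2: "q\<^sup>2 = 2 powr (- (s / 2))" by (simp add: q_def power2_eq_square flip: powr_add)
  \<comment> \<open>This product serves twice: it is the boundedness condition of
    \<open>Bseq_szego_rec_dyadic\<close> and, since a ball at level \<open>k\<close> costs a
    multiple of \<open>q ^ (4 * k)\<close>, also the ratio of the covering sums up to
    \<open>(real k + 1)\<^sup>2\<close>.\<close>
  have pq\<theta>: "2 * p * q\<^sup>2 = \<theta>"
  proof -
    have "2 * p * q\<^sup>2 = 2 powr 1 * 2 powr (- \<eta>) * 2 powr (- (s / 2))"
      by (simp add: p_def q2)
    also have "\<dots> = \<theta>" unfolding powr_add[symmetric] \<theta>_def by simp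
    finally show ?thesis .
  qed
  have \<theta>: "0 < \<theta>" "\<theta> < 1" using s powr_less_mono[of "1 - \<eta> - s / 2" 0 2] by (simp_all add: \<theta>_def)
  have finB: "finite (B k)" for k by (rule finite_subset[of _ "{..<2 ^ k}"]) (auto simp: B_def)
  have C: "0 \<le> C" using order_trans[OF sum_nonneg E[of 0]] by simp
  have card: "real (card (B k)) * (q\<^sup>2) ^ k \<le> (real k + 1)\<^sup>2 * (C * (2 * p) ^ k)" for k
  proof -
    have "real (card (B k)) * (q ^ k)\<^sup>2 \<le> (real k + 1)\<^sup>2 * (2 ^ k * (\<Sum>j\<in>{2 ^ k..<2 ^ Suc k}. (cmod (\<alpha> j))\<^sup>2))"
      unfolding B_def g_def using pq by (intro card_large_partial_sums) auto
    also have "\<dots> \<le> (real k + 1)\<^sup>2 * (2 ^ k * (C * p ^ k))"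
      unfolding p_def by (intro mult_left_mono E) auto
    finally show ?thesis by (simp add: power_mult_distrib mult_ac flip: power_mult)
  qed
  show ?thesis
  proof (rule hausdorff_measure_limsup_zero[of B "\<lambda>k i. cball (g k i) (2 * pi / 2 ^ k)" "\<lambda>k. 4 * pi / 2 ^ k"])
    have "(\<lambda>k. 4 * pi * (1 / 2) ^ k) \<longlonglongrightarrow> 4 * pi * 0"
      by (intro tendsto_mult tendsto_const LIMSEQ_power_zero) auto
    then show "(\<lambda>k. 4 * pi / 2 ^ k) \<longlonglongrightarrow> 0" by (simp add: power_divide)
    show "summable (\<lambda>k. \<Sum>i\<in>B k. diam_powr s (cball (g k i) (2 * pi / 2 ^ k)))"
    proof (rule summable_comparison_test')
      show "summable (\<lambda>k. (4 * pi) powr s * C * ((real k + 1)\<^sup>2 * \<theta> ^ k))"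
        using \<theta> by (intro summable_mult summable_square_geometric)
      fix k
      have "diam_powr s (cball (g k i) (2 * pi / 2 ^ k)) = (4 * pi) powr s * ((q\<^sup>2) ^ k * (q\<^sup>2) ^ k)" for i
      proof -
        have "diam_powr s (cball (g k i) (2 * pi / 2 ^ k)) = (4 * pi / 2 ^ k) powr s"
          using s0 divide_nonneg_pos[of "2 * pi" "2 ^ k"] by (auto simp: diam_powr_def not_less[symmetric])
        also have "\<dots> = (4 * pi) powr s / (2 powr real k) powr s"
          by (simp add: powr_divide powr_realpow)
        also have "(2 powr real k) powr s = 1 / ((q\<^sup>2) ^ k * (q\<^sup>2) ^ k)"
          unfolding q2 power_mult_distrib[symmetric] powr_add[symmetric]
          by (simp add: powr_powr powr_minus powr_power inverse_eq_divide mult_ac power_divide)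
        finally show ?thesis by simp
      qed
      then have "(\<Sum>i\<in>B k. diam_powr s (cball (g k i) (2 * pi / 2 ^ k))) =
          (4 * pi) powr s * (q\<^sup>2) ^ k * (real (card (B k)) * (q\<^sup>2) ^ k)" by simp
      also have "\<dots> \<le> (4 * pi) powr s * (q\<^sup>2) ^ k * ((real k + 1)\<^sup>2 * (C * (2 * p) ^ k))"
        by (intro mult_left_mono card) auto
      also have "\<dots> = (4 * pi) powr s * C * ((real k + 1)\<^sup>2 * \<theta> ^ k)"
        unfolding pq\<theta>[symmetric] by (simp add: power_mult_distrib mult_ac)
      finally show "norm (\<Sum>i\<in>B k. diam_powr s (cball (g k i) (2 * pi / 2 ^ k)))
          \<le> (4 * pi) powr s * C * ((real k + 1)\<^sup>2 * \<theta> ^ k)"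
        by (simp add: sum_nonneg diam_powr_nonneg)
    qed
    show "{z \<in> sphere 0 1. \<not> (Bseq (szego_rec \<alpha> z) \<and> Bseq (szego_rec (\<lambda>n. - \<alpha> n) z))}
        \<subseteq> (\<Union>k\<in>{k0..}. \<Union>i\<in>B k. cball (g k i) (2 * pi / 2 ^ k))" (is "?L \<subseteq> ?R") for k0
    proof
      fix z assume "z \<in> ?L"
      then have z: "cmod z = 1" and nb: "\<not> (Bseq (szego_rec \<alpha> z) \<and> Bseq (szego_rec (\<lambda>n. - \<alpha> n) z))"
        by auto
      show "z \<in> ?R"
      proof (rule ccontr)
        assume nR: "z \<notin> ?R"
        \<comment> \<open>Outside the bad balls, the bound at the grid point just before
          \<open>z\<close> is carried to \<open>z\<close>; \<open>1 + 2 * pi\<close> is the Abel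
          summation loss for at most \<open>2 ^ k\<close> terms over an arc of length
          \<open>2 * pi / 2 ^ k\<close>.\<close>
        have S: "cmod (\<Sum>j\<in>{2 ^ k..<n}. \<alpha> j * z ^ j) \<le> (1 + 2 * pi) * q ^ k"
          if k: "k0 \<le> k" "2 ^ k \<le> n" "n \<le> 2 ^ Suc k" for k n
        proof -
          obtain i t where it: "i < 2 ^ k" "0 \<le> t" "t \<le> 2 * pi / real (2 ^ k)" "z = g k i * cis t"
            unfolding g_def using circle_grid_point[OF z, of "2 ^ k"] by auto
          have c: "cmod (cis t - 1) \<le> 2 * pi / 2 ^ k"
            using dist_cis_le[of t 0] it by (simp add: dist_norm)
          have "dist (g k i) z = cmod (g k i * (cis t - 1))"
            unfolding it(4) dist_norm by (simp add: algebra_simps norm_minus_commute)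
          also have "\<dots> = cmod (cis t - 1)" by (simp add: norm_mult g_def)
          finally have "z \<in> cball (g k i) (2 * pi / 2 ^ k)" using c by simp
          then have "i \<notin> B k" using nR k by auto
          then have *: "cmod (\<Sum>j\<in>{2 ^ k..<n}. \<alpha> j * g k i ^ j) \<le> q ^ k" if "2 ^ k \<le> n" "n \<le> 2 ^ Suc k" for n
            using it that by (auto simp: B_def not_less)
          have "cmod (\<Sum>j\<in>{2 ^ k..<n}. \<alpha> j * (g k i * cis t) ^ j)
              \<le> q ^ k * (1 + real (n - 2 ^ k) * cmod (cis t - 1))"
            using k by (intro norm_sum_power_move *) auto
          also have "\<dots> \<le> q ^ k * (1 + 2 ^ k * (2 * pi / 2 ^ k))"
          proof (intro mult_left_mono add_left_mono mult_mono c)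
            have "real (n - 2 ^ k) \<le> real (2 ^ k)" using k by (intro of_nat_mono) simp
            then show "real (n - 2 ^ k) \<le> 2 ^ k" by simp
          qed (use pq in auto)
          finally show ?thesis by (simp add: it(4) mult.commute)
        qed
        have "Bseq (szego_rec \<alpha> z)"
          using Bseq_szego_rec_dyadic[OF z \<alpha> pq _ E[folded p_def] S] pq\<theta> \<theta> by simp
        \<comment> \<open>Block sums for \<open>- \<alpha>\<close> have the same modulus, so one
          family of bad balls serves both solutions.\<close>
        moreover have "Bseq (szego_rec (\<lambda>n. - \<alpha> n) z)"
          using Bseq_szego_rec_dyadic[OF z _ pq, of "\<lambda>n. - \<alpha> n" C k0 "1 + 2 * pi"]
            pq\<theta> \<theta> \<alpha> E[folded p_def] S by (simp add: sum_negf)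
        ultimately show False using nb by simp
      qed
    qed
  qed (auto intro: finB)
qed

section \<open>Comparing solutions at nearby points\<close>

lemma continuous_szego_rec: "continuous_on UNIV (\<lambda>z. szego_rec \<alpha> z n)"
proof (induction n)
  case (Suc n)
  then show ?case unfolding szego_rec.simps divide_inverse by (intro continuous_intros)
qed simp

lemma sqrt_one_minus_norm_sq:
  assumes "cmod a < 1"
  shows "sqrt (1 - (cmod a)\<^sup>2) > 0"
    and "complex_of_real (sqrt (1 - (cmod a)\<^sup>2)) * complex_of_real (sqrt (1 - (cmod a)\<^sup>2)) = 1 - a * cnj a"
proof -
  have *: "(cmod a)\<^sup>2 < 1" using assms by (simp add: power_less_one_iff)
  then show "sqrt (1 - (cmod a)\<^sup>2) > 0" by simp
  have "complex_of_real (sqrt (1 - (cmod a)\<^sup>2)) * complex_of_real (sqrt (1 - (cmod a)\<^sup>2)) =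
      complex_of_real (1 - (cmod a)\<^sup>2)"
    unfolding of_real_mult[symmetric] using * by simp
  also have "\<dots> = 1 - a * cnj a" by (simp only: of_real_diff complex_norm_square of_real_1)
  finally show "complex_of_real (sqrt (1 - (cmod a)\<^sup>2)) * complex_of_real (sqrt (1 - (cmod a)\<^sup>2)) = 1 - a * cnj a" .
qed

lemma cnj_mult_power_self:
  assumes "cmod z = 1"
  shows "z * cnj z = 1" "z ^ n * cnj z ^ n = 1"
proof -
  show *: "z * cnj z = 1" using assms by (simp add: complex_norm_square[symmetric])
  show "z ^ n * cnj z ^ n = 1" unfolding power_mult_distrib[symmetric] * by simp
qed

text \<open>With \<open>f n\<close> over \<open>z ^ n * cnj (f n)\<close> and \<open>g n\<close>
  over \<open>- z ^ n * cnj (g n)\<close> as columns, the determinant is \<open>- z ^ n\<close>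
  times this sum, and the matrix of one Szego step has determinant \<open>z\<close>.\<close>

lemma szego_rec_wronskian:
  assumes z: "cmod z = 1" and \<alpha>: "\<And>n. cmod (\<alpha> n) < 1"
  defines "f \<equiv> szego_rec \<alpha> z" and "g \<equiv> szego_rec (\<lambda>n. - \<alpha> n) z"
  shows "f n * cnj (g n) + cnj (f n) * g n = 2"
proof (induction n)
  case (Suc n)
  define r where "r = complex_of_real (sqrt (1 - (cmod (\<alpha> n))\<^sup>2))"
  define a where "a = \<alpha> n"
  define x where "x = f n"
  define y where "y = g n"
  have r: "r \<noteq> 0" "r * r = 1 - a * cnj a" "cnj r = r"
    unfolding r_def a_def using sqrt_one_minus_norm_sq[OF \<alpha>[of n]] by auto
  have f: "f (Suc n) = (z * x - cnj a * z ^ n * cnj x) / r" 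
    and g: "g (Suc n) = (z * y + cnj a * z ^ n * cnj y) / r"
    by (simp_all add: f_def g_def x_def y_def r_def a_def)
  \<comment> \<open>Conjugates get names of their own: the step becomes a polynomial identity in
    independent letters, modulo \<open>z * Z = 1\<close> and \<open>w * W = 1\<close>.\<close>
  define Z where "Z = cnj z"
  define w where "w = z ^ n"
  define W where "W = cnj z ^ n"
  define X where "X = cnj x"
  define Y where "Y = cnj y"
  define b where "b = cnj a"
  have zz: "z * Z = 1" "w * W = 1"
    unfolding Z_def w_def W_def using cnj_mult_power_self[OF z] by auto
  have IH: "x * Y + X * y = 2" using Suc by (simp add: x_def y_def X_def Y_def)
  have "(f (Suc n) * cnj (g (Suc n)) + cnj (f (Suc n)) * g (Suc n)) * (r * r) =
     (z * x - b * w * X) * (Z * Y + a * W * y) + (Z * X - a * W * x) * (z * y + b * w * Y)"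
    unfolding f g using r by (simp add: w_def W_def Z_def X_def Y_def b_def field_simps)
  also have "\<dots> = (z * Z) * (x * Y + X * y) - a * b * (w * W) * (x * Y + X * y)"
    by (simp add: algebra_simps)
  also have "\<dots> = 2 * (1 - a * b)" unfolding IH zz by (simp add: algebra_simps)
  also have "\<dots> = 2 * (r * r)" by (simp add: r b_def)
  finally show ?case using r by (metis mult_cancel_right mult_eq_0_iff)
qed (simp add: f_def g_def)

text \<open>Variation of constants: the transfer matrix at \<open>w\<close> is that at \<open>z\<close> times a diagonal
  matrix that differs from the identity only by \<open>w / z - 1\<close> in the upper left entry.\<close>
lemma szego_rec_variation:
  assumes z: "cmod z = 1" and w: "cmod w = 1" and \<alpha>: "\<And>n. cmod (\<alpha> n) < 1"
  defines "f \<equiv> szego_rec \<alpha> z" and "g \<equiv> szego_rec (\<lambda>n. - \<alpha> n) z" and "h \<equiv> szego_rec \<alpha> w"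
    and "u \<equiv> w * cnj z - 1"
  shows "2 * h n = 2 * f n + u * ((\<Sum>j<n. h j * cnj (g j)) * f n + (\<Sum>j<n. h j * cnj (f j)) * g n)"
    and "2 * (w ^ n * cnj (h n)) = z ^ n * (2 * cnj (f n) +
      u * ((\<Sum>j<n. h j * cnj (g j)) * cnj (f n) - (\<Sum>j<n. h j * cnj (f j)) * cnj (g n)))"
proof (induction n)
  case 0
  show "2 * h 0 = 2 * f 0 + u * ((\<Sum>j<0. h j * cnj (g j)) * f 0 + (\<Sum>j<0. h j * cnj (f j)) * g 0)"
    and "2 * (w ^ 0 * cnj (h 0)) = z ^ 0 * (2 * cnj (f 0) +
      u * ((\<Sum>j<0. h j * cnj (g j)) * cnj (f 0) - (\<Sum>j<0. h j * cnj (f j)) * cnj (g 0)))"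
    by (simp_all add: h_def f_def)
next
  case (Suc n)
  define r where "r = complex_of_real (sqrt (1 - (cmod (\<alpha> n))\<^sup>2))"
  define a where "a = \<alpha> n"
  define P where "P = (\<Sum>j<n. h j * cnj (g j))"
  define Q where "Q = (\<Sum>j<n. h j * cnj (f j))"
  define x where "x = f n"
  define y where "y = g n"
  define X where "X = cnj (f n)"
  define Y where "Y = cnj (g n)"
  define t where "t = h n"
  define T where "T = w ^ n * cnj (h n)"
  define zn where "zn = z ^ n"
  define zN where "zN = cnj z ^ n"
  define Z where "Z = cnj z"
  define b where "b = cnj a"
  have r: "r \<noteq> 0" "cnj r = r"
    unfolding r_def using sqrt_one_minus_norm_sq[OF \<alpha>[of n]] by auto
  have f: "r * f (Suc n) = z * x - b * zn * X" and g: "r * g (Suc n) = z * y + b * zn * Y"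
    and h: "r * h (Suc n) = w * t - b * T"
    using r by (simp_all add: f_def g_def h_def x_def y_def X_def Y_def r_def a_def b_def zn_def t_def T_def)
  have "cnj (r * f (Suc n)) = cnj (z * x - b * zn * X)" "cnj (r * g (Suc n)) = cnj (z * y + b * zn * Y)"
    by (simp_all only: f g)
  then have cf: "r * cnj (f (Suc n)) = Z * X - a * zN * x" and cg: "r * cnj (g (Suc n)) = Z * Y + a * zN * y"
    by (simp_all add: r x_def y_def X_def Y_def b_def zn_def zN_def Z_def)
  have zz: "z * Z = 1" "zn * zN = 1"
    unfolding Z_def zn_def zN_def using cnj_mult_power_self[OF z] by auto
  have ww: "w * cnj w = 1" "w ^ n * cnj w ^ n = 1" using cnj_mult_power_self[OF w] by auto
  have "r * (w ^ Suc n * cnj (h (Suc n))) = w ^ Suc n * cnj (r * h (Suc n))" using r by simp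
  also have "\<dots> = (w * cnj w) * T - a * w * (w ^ n * cnj w ^ n) * t"
    unfolding h by (simp add: T_def t_def b_def algebra_simps)
  finally have ch: "r * (w ^ Suc n * cnj (h (Suc n))) = T - a * w * t" unfolding ww by simp
  have wu: "w = z * (1 + u)" using zz by (simp add: u_def Z_def algebra_simps)
  have IH: "2 * t = 2 * x + u * (P * x + Q * y)" "2 * T = zn * (2 * X + u * (P * X - Q * Y))"
    using Suc by (simp_all add: t_def T_def x_def y_def X_def Y_def P_def Q_def zn_def)
  have W: "x * Y + X * y = 2"
    using szego_rec_wronskian[OF z, of \<alpha> n] \<alpha> by (simp add: x_def y_def X_def Y_def f_def g_def)
  have S: "(\<Sum>j<Suc n. h j * cnj (g j)) = P + t * Y" "(\<Sum>j<Suc n. h j * cnj (f j)) = Q + t * X"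
    by (simp_all add: P_def Q_def t_def X_def Y_def)
  have "r * (2 * h (Suc n)) = 2 * (w * t - b * T)" unfolding h[symmetric] by simp
  \<comment> \<open>Replacing \<open>w\<close> by \<open>z * (1 + u)\<close> leaves the source term
    \<open>2 * u * z * t\<close>; writing its 2 as \<open>x * Y + X * y\<close> produces the new
    summands of \<open>P\<close> and \<open>Q\<close>.\<close>
  also have "\<dots> = 2 * (z * x - b * zn * X) + u * ((P + t * Y) * (z * x - b * zn * X) + (Q + t * X) * (z * y + b * zn * Y))"
    using IH W wu by algebra
  also have "\<dots> = r * (2 * f (Suc n) + u * ((P + t * Y) * f (Suc n) + (Q + t * X) * g (Suc n)))"
    unfolding f[symmetric] g[symmetric] by (simp add: algebra_simps)
  finally show "2 * h (Suc n) = 2 * f (Suc n) + u * ((\<Sum>j<Suc n. h j * cnj (g j)) * f (Suc n) + (\<Sum>j<Suc n. h j * cnj (f j)) * g (Suc n))"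
    unfolding S using r by simp
  have "r * (2 * (w ^ Suc n * cnj (h (Suc n)))) = 2 * (T - a * w * t)" unfolding ch[symmetric] by simp
  also have "\<dots> = z * zn * (2 * (Z * X - a * zN * x) +
      u * ((P + t * Y) * (Z * X - a * zN * x) - (Q + t * X) * (Z * Y + a * zN * y)))"
    using IH W wu zz by algebra
  also have "\<dots> = r * (z ^ Suc n * (2 * cnj (f (Suc n)) + u * ((P + t * Y) * cnj (f (Suc n)) - (Q + t * X) * cnj (g (Suc n)))))"
    unfolding cf[symmetric] cg[symmetric] by (simp add: algebra_simps zn_def)
  finally show "2 * (w ^ Suc n * cnj (h (Suc n))) = z ^ Suc n * (2 * cnj (f (Suc n)) +
      u * ((\<Sum>j<Suc n. h j * cnj (g j)) * cnj (f (Suc n)) - (\<Sum>j<Suc n. h j * cnj (f j)) * cnj (g (Suc n))))"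
    unfolding S using r by (simp only: mult_left_cancel not_False_eq_True)
qed

lemma szego_rec_lower_bound:
  assumes z: "cmod z = 1" and \<alpha>: "\<And>n. cmod (\<alpha> n) < 1"
    and g: "\<And>n. cmod (szego_rec (\<lambda>n. - \<alpha> n) z n) \<le> C"
  shows "1 \<le> C * cmod (szego_rec \<alpha> z n)"
proof -
  let ?f = "szego_rec \<alpha> z n" and ?g = "szego_rec (\<lambda>n. - \<alpha> n) z n"
  have "2 = cmod (?f * cnj ?g + cnj ?f * ?g)" by (simp only: szego_rec_wronskian[OF z, of \<alpha> n, OF \<alpha>]) simp
  also have "\<dots> \<le> 2 * (cmod ?f * cmod ?g)"
    by (rule order_trans[OF norm_triangle_ineq]) (simp add: norm_mult)
  also have "\<dots> \<le> 2 * (cmod ?f * C)" using g by (intro mult_left_mono) auto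
  finally show ?thesis by (simp add: mult.commute)
qed

text \<open>A bootstrap: earlier values within \<open>1 / (2 * C)\<close> of those at
  \<open>z\<close> are at most \<open>2 * C\<close>, and the variation formula, with at most
  \<open>N\<close> terms of size \<open>4 * C ^ 3\<close>, reproduces the tolerance. That tolerance
  is half the lower bound \<open>1 / C\<close> for the solution at \<open>z\<close>.\<close>

lemma szego_rec_near:
  assumes z: "cmod z = 1" and w: "cmod w = 1" and \<alpha>: "\<And>n. cmod (\<alpha> n) < 1"
    and f: "\<And>n. cmod (szego_rec \<alpha> z n) \<le> C" and g: "\<And>n. cmod (szego_rec (\<lambda>n. - \<alpha> n) z n) \<le> C"
    and near: "4 * C ^ 4 * real N * cmod (w - z) \<le> 1" and "n \<le> N"
  shows "cmod (szego_rec \<alpha> w n - szego_rec \<alpha> z n) \<le> 1 / (2 * C)"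
  using \<open>n \<le> N\<close>
proof (induction n rule: less_induct)
  case (less n)
  define F where "F = szego_rec \<alpha> z"
  define G where "G = szego_rec (\<lambda>n. - \<alpha> n) z"
  define h where "h = szego_rec \<alpha> w"
  define u where "u = w * cnj z - 1"
  have C1: "1 \<le> C" using f[of 0] by simp
  have u: "cmod u = cmod (w - z)"
  proof -
    have "u = (w - z) * cnj z" using cnj_mult_power_self(1)[OF z] by (simp add: u_def algebra_simps)
    then show ?thesis by (simp add: norm_mult z)
  qed
  have "2 * (h n - F n) = u * (\<Sum>j<n. h j * (cnj (G j) * F n + cnj (F j) * G n))"
    using szego_rec_variation(1)[OF z w, of \<alpha> n, OF \<alpha>]
    by (simp add: h_def F_def G_def u_def algebra_simps sum_distrib_left sum.distrib)
  then have "2 * cmod (h n - F n) = cmod u * cmod (\<Sum>j<n. h j * (cnj (G j) * F n + cnj (F j) * G n))"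
    by (metis norm_mult norm_numeral)
  also have "\<dots> \<le> cmod u * (\<Sum>j<n. 2 * C * (2 * C\<^sup>2))"
  proof (intro mult_left_mono sum_norm_le)
    fix j assume j: "j \<in> {..<n}"
    have "cmod (h j) \<le> cmod (h j - F j) + cmod (F j)" using norm_triangle_ineq[of "h j - F j" "F j"] by simp
    also have "\<dots> \<le> 1 / (2 * C) + C"
      using less j f[of j] by (intro add_mono) (auto simp: h_def F_def)
    also have "1 / (2 * C) \<le> C" using C1 mult_mono[of 1 C 1 C] by (simp add: field_simps)
    finally have hj: "cmod (h j) \<le> 2 * C" by simp
    have "cmod (cnj (G j) * F n + cnj (F j) * G n) \<le> cmod (G j) * cmod (F n) + cmod (F j) * cmod (G n)"
      by (rule order_trans[OF norm_triangle_ineq]) (simp add: norm_mult)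
    also have "\<dots> \<le> C * C + C * C"
      using f g C1 unfolding F_def G_def by (intro add_mono mult_mono) auto
    finally have "cmod (cnj (G j) * F n + cnj (F j) * G n) \<le> 2 * C\<^sup>2" by (simp add: power2_eq_square)
    with hj show "cmod (h j * (cnj (G j) * F n + cnj (F j) * G n)) \<le> 2 * C * (2 * C\<^sup>2)"
      unfolding norm_mult using C1 by (intro mult_mono) auto
  qed auto
  also have "\<dots> = 4 * C ^ 3 * real n * cmod (w - z)"
    by (simp add: u power2_eq_square power3_eq_cube mult_ac)
  also have "\<dots> \<le> 4 * C ^ 3 * real N * cmod (w - z)"
    using less.prems C1 by (intro mult_right_mono mult_left_mono) auto
  also have "\<dots> = 4 * C ^ 4 * real N * cmod (w - z) / C"
    using C1 by (simp add: power_eq_if)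
  also have "\<dots> \<le> 1 / C" using near C1 by (intro divide_right_mono) auto
  finally show ?case by (simp add: h_def F_def)
qed

section \<open>Mass of balls around points with bounded solutions\<close>

lemma borel_measurable_circle:
  fixes h :: "complex \<Rightarrow> 'b::{second_countable_topology, real_normed_vector}"
  assumes "sets M = sets circle_borel" "continuous_on UNIV h"
  shows "h \<in> borel_measurable M"
  unfolding measurable_cong_sets[OF assms(1) refl]
  by (rule measurable_restrict_space1[OF borel_measurable_continuous_onI[OF assms(2)]])

lemma space_circle:
  assumes "sets M = sets circle_borel"
  shows "space M = sphere 0 1"
  unfolding sets_eq_imp_space_eq[OF assms] by (subst space_restrict_space) simp

lemma integrable_circle:
  fixes h :: "complex \<Rightarrow> 'b::{banach, second_countable_topology}"
  assumes "sets M = sets circle_borel" "finite_measure M" "continuous_on UNIV h"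
  shows "integrable M h"
proof -
  have "compact (h ` sphere 0 1)"
    using assms(3) by (intro compact_continuous_image compact_sphere) (auto intro: continuous_on_subset)
  then obtain B where "\<And>x. x \<in> sphere 0 1 \<Longrightarrow> norm (h x) \<le> B"
    using compact_imp_bounded[of "h ` sphere 0 1"] unfolding bounded_iff by blast
  moreover have "space M = sphere 0 1" by (rule space_circle[OF assms(1)])
  ultimately show ?thesis
    by (intro finite_measure.integrable_const_bound[OF assms(2), of _ B]
        borel_measurable_circle[OF assms(1,3)] AE_I2) simp
qed

text \<open>The kernel \<open>K\<close> in the proof, Christoffel-Darboux at \<open>z\<close>, has squared \<open>L\<^sup>2\<close> norm
  \<open>\<kappa>\<close>, its value at \<open>z\<close>, and exceeds \<open>\<kappa> / 2\<close> near \<open>z\<close>.\<close>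
lemma measure_near_bounded_szego_rec:
  assumes M: "sets M = sets circle_borel" "prob_space M"
    and \<alpha>: "\<And>n. cmod (\<alpha> n) < 1"
    and on: "\<And>i j. (LINT w|M. cnj (szego_rec \<alpha> w i) * szego_rec \<alpha> w j) = (if i = j then 1 else 0)"
    and z: "cmod z = 1"
    and f: "\<And>n. cmod (szego_rec \<alpha> z n) \<le> C" and g: "\<And>n. cmod (szego_rec (\<lambda>n. - \<alpha> n) z n) \<le> C"
    and near: "4 * C ^ 4 * real N * r \<le> 1" "N > 0" 
  shows "measure M (cball z r \<inter> sphere 0 1) * real N \<le> 4 * C\<^sup>2"
proof -
  interpret prob_space M by (rule M(2))
  define F where "F = szego_rec \<alpha> z"
  define K where "K w = (\<Sum>j<N. cnj (F j) * szego_rec \<alpha> w j)" for w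
  define \<kappa> where "\<kappa> = (\<Sum>j<N. (cmod (F j))\<^sup>2)"
  define A where "A = cball z r \<inter> sphere 0 1"
  have C1: "1 \<le> C" using f[of 0] by simp
  have A[measurable]: "A \<in> sets M"
    unfolding M(1) A_def sets_restrict_space by (rule image_eqI[of _ _ "cball z r"]) auto
  have int: "integrable M h" if "continuous_on UNIV h" for h :: "complex \<Rightarrow> complex"
    using integrable_circle[OF M(1) finite_measure_axioms that] .
  have I: "integrable M (\<lambda>w. c * (cnj (szego_rec \<alpha> w i) * szego_rec \<alpha> w j))" for c i j
    by (intro int continuous_intros continuous_szego_rec)
  have contK: "continuous_on UNIV K"
    unfolding K_def by (intro continuous_intros continuous_szego_rec)
  have intK: "integrable M (\<lambda>w. (cmod (K w))\<^sup>2)"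
    by (intro integrable_circle[OF M(1) finite_measure_axioms] continuous_intros contK)
  have "complex_of_real (LINT w|M. (cmod (K w))\<^sup>2) = (LINT w|M. K w * cnj (K w))"
    unfolding integral_complex_of_real[symmetric] by (simp only: complex_norm_square)
  also have "\<dots> = (LINT w|M. (\<Sum>j<N. \<Sum>i<N. cnj (F j) * F i * (cnj (szego_rec \<alpha> w i) * szego_rec \<alpha> w j)))"
  proof (rule arg_cong[of _ _ "lebesgue_integral M"], rule ext)
    fix w
    have "K w * cnj (K w) = (\<Sum>j<N. cnj (F j) * szego_rec \<alpha> w j) * (\<Sum>i<N. F i * cnj (szego_rec \<alpha> w i))"
      by (simp add: K_def)
    also have "\<dots> = (\<Sum>j<N. \<Sum>i<N. (cnj (F j) * szego_rec \<alpha> w j) * (F i * cnj (szego_rec \<alpha> w i)))"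
      by (rule sum_product)
    also have "\<dots> = (\<Sum>j<N. \<Sum>i<N. cnj (F j) * F i * (cnj (szego_rec \<alpha> w i) * szego_rec \<alpha> w j))"
      by (intro sum.cong refl) simp
    finally show "K w * cnj (K w) = (\<Sum>j<N. \<Sum>i<N. cnj (F j) * F i * (cnj (szego_rec \<alpha> w i) * szego_rec \<alpha> w j))" .
  qed
  also have "\<dots> = (\<Sum>j<N. LINT w|M. (\<Sum>i<N. cnj (F j) * F i * (cnj (szego_rec \<alpha> w i) * szego_rec \<alpha> w j)))"
    by (rule Bochner_Integration.integral_sum) (intro Bochner_Integration.integrable_sum I)
  also have "\<dots> = (\<Sum>j<N. \<Sum>i<N. LINT w|M. cnj (F j) * F i * (cnj (szego_rec \<alpha> w i) * szego_rec \<alpha> w j))"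
    by (intro sum.cong refl Bochner_Integration.integral_sum I)
  also have "\<dots> = (\<Sum>j<N. \<Sum>i<N. cnj (F j) * F i * (LINT w|M. cnj (szego_rec \<alpha> w i) * szego_rec \<alpha> w j))"
    by (simp only: integral_mult_right_zero)
  also have "\<dots> = (\<Sum>j<N. \<Sum>i<N. if j = i then cnj (F j) * F i else 0)"
    by (intro sum.cong refl) (simp add: on)
  also have "\<dots> = complex_of_real \<kappa>"
    unfolding \<kappa>_def of_real_sum complex_norm_square by (simp add: sum.delta mult.commute)
  finally have IK: "(LINT w|M. (cmod (K w))\<^sup>2) = \<kappa>" unfolding of_real_eq_iff .
  have Flow: "1 / C \<le> cmod (F j)" for j
    using szego_rec_lower_bound[OF z, of \<alpha> C j, OF \<alpha> g] C1 by (simp add: F_def field_simps)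
  have \<kappa>N: "real N / C\<^sup>2 \<le> \<kappa>"
  proof -
    have "(\<Sum>j<N. (1 / C)\<^sup>2) \<le> \<kappa>" unfolding \<kappa>_def using Flow C1 by (intro sum_mono power_mono) auto
    then show ?thesis by (simp add: power_divide)
  qed
  then have \<kappa>0: "0 < \<kappa>" using near(2) C1 by (smt (verit) divide_pos_pos of_nat_0_less_iff zero_less_power)
  have Klow: "\<kappa> / 2 \<le> cmod (K w)" if "w \<in> A" for w
  proof -
    have w: "cmod w = 1" "cmod (w - z) \<le> r" using that by (auto simp: A_def dist_norm norm_minus_commute)
    have "4 * C ^ 4 * real N * cmod (w - z) \<le> 4 * C ^ 4 * real N * r"
      using w C1 by (intro mult_left_mono) auto
    then have n': "4 * C ^ 4 * real N * cmod (w - z) \<le> 1" using near(1) by simp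
    \<comment> \<open>Each summand keeps at least half of its value at \<open>z\<close>, since the
      deviation is at most half of \<open>cmod (F j)\<close>; real parts therefore cannot
      cancel.\<close>
    have "(\<Sum>j<N. (cmod (F j))\<^sup>2 / 2) \<le> (\<Sum>j<N. Re (cnj (F j) * szego_rec \<alpha> w j))"
    proof (rule sum_mono)
      fix j assume j: "j \<in> {..<N}"
      define d where "d = szego_rec \<alpha> w j - F j"
      have "cmod d \<le> 1 / (2 * C)"
        unfolding d_def F_def using j by (intro szego_rec_near[OF z w(1) \<alpha> f g n']) auto
      also have "\<dots> \<le> cmod (F j) / 2" using Flow[of j] by simp
      finally have d: "cmod d \<le> cmod (F j) / 2" .
      have "cnj (F j) * szego_rec \<alpha> w j = of_real ((cmod (F j))\<^sup>2) + cnj (F j) * d"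
        unfolding complex_norm_square d_def by (simp add: algebra_simps)
      then have "Re (cnj (F j) * szego_rec \<alpha> w j) = (cmod (F j))\<^sup>2 + Re (cnj (F j) * d)"
        by (simp only: plus_complex.sel Re_complex_of_real)
      moreover have "\<bar>Re (cnj (F j) * d)\<bar> \<le> cmod (F j) * cmod d"
        using abs_Re_le_cmod[of "cnj (F j) * d"] by (simp only: norm_mult complex_mod_cnj)
      moreover have "cmod (F j) * cmod d \<le> cmod (F j) * (cmod (F j) / 2)"
        using d by (intro mult_left_mono) auto
      moreover have "cmod (F j) * (cmod (F j) / 2) = (cmod (F j))\<^sup>2 / 2" by (simp add: power2_eq_square)
      ultimately show "(cmod (F j))\<^sup>2 / 2 \<le> Re (cnj (F j) * szego_rec \<alpha> w j)" by linarith
    qed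
    also have "\<dots> = Re (K w)" by (simp only: K_def Re_sum)
    also have "\<dots> \<le> cmod (K w)" by (rule complex_Re_le_cmod)
    finally show ?thesis by (simp add: \<kappa>_def sum_divide_distrib)
  qed
  \<comment> \<open>Chebyshev on \<open>A\<close>; it remains to divide by \<open>\<kappa>\<close>
    and to use \<open>\<kappa> \<ge> N / C\<^sup>2\<close>.\<close>
  have "measure M A * (\<kappa> / 2)\<^sup>2 = (LINT w|M. indicator A w * (\<kappa> / 2)\<^sup>2)"
    using A sets.sets_into_space[OF A] by (simp add: Int_absorb2)
  also have "\<dots> \<le> (LINT w|M. (cmod (K w))\<^sup>2)"
  proof (rule integral_mono)
    show "integrable M (\<lambda>w. indicator A w * (\<kappa> / 2)\<^sup>2)"
      by (rule integrable_mult_left, rule integrable_real_indicator[OF A])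
        (simp add: less_top[symmetric] emeasure_finite)
    show "indicator A w * (\<kappa> / 2)\<^sup>2 \<le> (cmod (K w))\<^sup>2" for w
    proof (cases "w \<in> A")
      case True
      have "(\<kappa> / 2)\<^sup>2 \<le> (cmod (K w))\<^sup>2" using \<kappa>0 by (intro power_mono Klow[OF True]) simp
      with True show ?thesis by (simp only: indicator_simps mult_1)
    qed simp
  qed (rule intK)
  finally have "measure M A * (\<kappa> / 2)\<^sup>2 \<le> \<kappa>" unfolding IK .
  then have "measure M A * \<kappa> \<le> 4" using \<kappa>0 by (simp add: power2_eq_square field_simps)
  moreover have "measure M A * (real N / C\<^sup>2) \<le> measure M A * \<kappa>" using \<kappa>N by (intro mult_left_mono) auto
  ultimately have "measure M A * (real N / C\<^sup>2) \<le> 4" by simp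
  then show ?thesis using C1 unfolding A_def by (simp add: field_simps)
qed

text \<open>\<open>N\<close> is as large as nearness permits, the integer part of
  \<open>1 / q\<close> with \<open>q = 4 * C ^ 4 * r\<close>, so that
  \<open>1 \<le> 2 * N * q\<close>. For \<open>q > 1\<close> the bound is at least the total mass
  1.\<close>

lemma measure_ball_bounded_szego_rec:
  assumes M: "sets M = sets circle_borel" "prob_space M"
    and \<alpha>: "\<And>n. cmod (\<alpha> n) < 1"
    and on: "\<And>i j. (LINT w|M. cnj (szego_rec \<alpha> w i) * szego_rec \<alpha> w j) = (if i = j then 1 else 0)"
    and z: "cmod z = 1"
    and f: "\<And>n. cmod (szego_rec \<alpha> z n) \<le> C" and g: "\<And>n. cmod (szego_rec (\<lambda>n. - \<alpha> n) z n) \<le> C"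
    and r: "r > 0"
  shows "measure M (cball z r \<inter> sphere 0 1) \<le> 32 * C ^ 6 * r"
proof -
  interpret prob_space M by (rule M(2))
  have C1: "1 \<le> C" using f[of 0] by simp
  define q where "q = 4 * C ^ 4 * r"
  define m where "m = measure M (cball z r \<inter> sphere 0 1)"
  have q0: "0 < q" using C1 r by (simp add: q_def)
  have "C ^ 6 = C\<^sup>2 * C ^ 4" unfolding power_add[symmetric] by simp
  then have c6: "32 * C ^ 6 * r = 8 * C\<^sup>2 * q" by (simp add: q_def)
  show ?thesis
  proof (cases "q \<le> 1")
    case True
    define N where "N = nat \<lfloor>1 / q\<rfloor>"
    have "1 \<le> 1 / q" using True q0 by simp
    then have N: "real N \<le> 1 / q" "1 / q < real N + 1" "1 \<le> N"
      unfolding N_def by linarith+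
    have "real N * q \<le> 1" using N(1) q0 by (simp only: pos_le_divide_eq)
    moreover have "4 * C ^ 4 * real N * r = real N * q" by (simp add: q_def)
    ultimately have n: "4 * C ^ 4 * real N * r \<le> 1" by (simp only:)
    have "N > 0" using N by simp
    from measure_near_bounded_szego_rec[OF M \<alpha> on z f g n this]
    have mN: "m * real N \<le> 4 * C\<^sup>2" unfolding m_def .
    have "1 / q \<le> 2 * real N" using N by linarith
    then have "1 \<le> 2 * real N * q" using q0 by (simp only: pos_divide_le_eq)
    then have "m * 1 \<le> m * (2 * real N * q)" by (intro mult_left_mono) (simp_all add: m_def)
    also have "\<dots> = 2 * (m * real N) * q" by simp
    also have "\<dots> \<le> 2 * (4 * C\<^sup>2) * q" using mN q0 by (intro mult_right_mono mult_left_mono) auto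
    finally show ?thesis unfolding c6 m_def by simp
  next
    case False
    have "1 \<le> 8 * C\<^sup>2" using one_le_power[OF C1, of 2] by linarith
    then have "1 * 1 \<le> 8 * C\<^sup>2 * q" using False by (intro mult_mono) auto
    then show ?thesis unfolding c6 by (intro order_trans[OF prob_le_1]) simp
  qed
qed

section \<open>Null sets and the singular part\<close>

lemma emeasure_circle_lebesgue:
  assumes "Z \<in> sets circle_borel"
  shows "cis -` Z \<inter> {0..<2 * pi} \<in> sets lborel"
    and "emeasure circle_lebesgue Z = emeasure lborel (cis -` Z \<inter> {0..<2 * pi})"
proof -
  have "cis \<in> borel_measurable lborel"
    using borel_measurable_continuous_onI[of cis] by (simp add: cis_conv_exp continuous_intros)
  then have m: "cis \<in> measurable (restrict_space lborel {0..<2 * pi}) circle_borel"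
    by (intro measurable_restrict_space2 measurable_restrict_space1) auto
  have sp: "space (restrict_space lborel {0..<2 * pi}) = {0..<2 * pi}"
    by (subst space_restrict_space) simp
  have *: "cis -` Z \<inter> {0..<2 * pi} \<in> sets (restrict_space lborel {0..<2 * pi})"
    using measurable_sets[OF m assms] unfolding sp .
  then show "cis -` Z \<inter> {0..<2 * pi} \<in> sets lborel"
    by (subst (asm) sets_restrict_space_iff) auto
  have "emeasure circle_lebesgue Z = emeasure (restrict_space lborel {0..<2 * pi}) (cis -` Z \<inter> {0..<2 * pi})"
    unfolding circle_lebesgue_def by (subst emeasure_distr[OF m assms]) (simp only: sp)
  also have "\<dots> = emeasure lborel (cis -` Z \<inter> {0..<2 * pi})"
    by (rule emeasure_restrict_space) auto
  finally show "emeasure circle_lebesgue Z = emeasure lborel (cis -` Z \<inter> {0..<2 * pi})" .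
qed

text \<open>Every interval has to meet \<open>T\<close>, because ball growth will be known only at
  points of the set. Disjoint interiors inside a small open superset of \<open>T\<close> keep the
  total length small.\<close>

lemma null_set_cover_intervals:
  fixes T :: "real set"
  assumes T: "T \<subseteq> {a..b}" "a < b" "T \<in> null_sets lborel" and e: "e > 0"
  shows "\<exists>(c :: nat \<Rightarrow> real) d J. T \<subseteq> (\<Union>n\<in>J. {c n..d n}) \<and>
    (\<forall>n\<in>J. c n < d n \<and> T \<inter> {c n..d n} \<noteq> {}) \<and>
    (\<Sum>n. if n \<in> J then ennreal (d n - c n) else 0) \<le> ennreal e"
proof -
  have "T \<in> sets borel" using T(3) by auto
  then obtain U where U: "open U" "T \<subseteq> U" "emeasure lborel (U - T) < ennreal e"
    using outer_regular_lborel[of T e] e by auto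
  have mU: "U \<in> sets lborel" using U(1) by simp
  have eU: "emeasure lborel U \<le> ennreal e"
  proof -
    have "emeasure lborel U = emeasure lborel (U - T)"
      using emeasure_Diff_null_set[OF T(3) mU] by simp
    then show ?thesis using U(3) by simp
  qed
  \<comment> \<open>This gauge forces every interval tagged by a point of \<open>T\<close> into
    \<open>U\<close>.\<close>
  define g where "g x = (if x \<in> U then U else UNIV)" for x
  have g: "gauge g" unfolding gauge_def g_def using U(1) by auto
  have "T \<subseteq> cbox a b" "box a b \<noteq> {}" using T by auto
  from covering_lemma[OF this g] obtain D where D: "countable D"
      "\<And>K. K \<in> D \<Longrightarrow> interior K \<noteq> {} \<and> (\<exists>c d. K = cbox c d)"
      "pairwise (\<lambda>A B. interior A \<inter> interior B = {}) D"
      "\<And>K. K \<in> D \<Longrightarrow> \<exists>x\<in>T \<inter> K. K \<subseteq> g x" "T \<subseteq> \<Union>D"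
    by metis
  define J where "J = to_nat_on D ` D"
  define k where "k n = from_nat_into D n" for n
  have kD: "k n \<in> D" if "n \<in> J" for n
    using that D(1) by (auto simp: J_def k_def)
  have kinj: "n = m" if "n \<in> J" "m \<in> J" "k n = k m" for n m
    using that D(1) by (auto simp: J_def k_def)
  have "\<exists>c d. k n = {c..d} \<and> c < d" if "n \<in> J" for n
  proof -
    note D2 = D(2)[OF kD[OF that]]
    then obtain c d where "k n = {c..d}" "interior (k n) \<noteq> {}" by auto
    then have "k n = {c..d} \<and> c < d" by (auto simp: interior_atLeastAtMost_real)
    then show ?thesis by blast
  qed
  then obtain c d where cd: "\<And>n. n \<in> J \<Longrightarrow> k n = {c n..d n} \<and> c n < d n" by metis
  define I where "I n = (if n \<in> J then interior (k n) else {})" for n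
  have I: "I n \<in> sets lborel" for n by (simp add: I_def)
  have "disjoint_family I"
    unfolding disjoint_family_on_def
  proof (intro ballI impI)
    fix m n :: nat assume "m \<noteq> n"
    then show "I m \<inter> I n = {}"
      using D(3) kD[of m] kD[of n] kinj[of m n] unfolding I_def pairwise_def by auto
  qed
  then have "(\<Sum>n. emeasure lborel (I n)) = emeasure lborel (\<Union>n. I n)"
    using I by (intro suminf_emeasure) auto
  also have "\<dots> \<le> emeasure lborel U"
  proof (intro emeasure_mono mU UN_least)
    fix n show "I n \<subseteq> U"
    proof (cases "n \<in> J")
      case True
      then obtain x where "x \<in> T" "k n \<subseteq> g x" using D(4) kD by blast
      then have "k n \<subseteq> U" using subsetD[OF U(2)] by (simp add: g_def)
      then show ?thesis using interior_subset[of "k n"] by (auto simp: I_def)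
    qed (simp add: I_def)
  qed
  also note eU
  also have "(\<lambda>n. emeasure lborel (I n)) = (\<lambda>n. if n \<in> J then ennreal (d n - c n) else 0)"
  proof
    fix n show "emeasure lborel (I n) = (if n \<in> J then ennreal (d n - c n) else 0)"
      using cd[of n] by (cases "n \<in> J") (simp_all add: I_def interior_atLeastAtMost_real emeasure_lborel_Ioo)
  qed
  finally have s: "(\<Sum>n. if n \<in> J then ennreal (d n - c n) else 0) \<le> ennreal e" .
  show ?thesis
  proof (intro exI conjI ballI)
    show "T \<subseteq> (\<Union>n\<in>J. {c n..d n})"
    proof
      fix x assume "x \<in> T"
      then obtain K where K: "K \<in> D" "x \<in> K" using D(5) by auto
      then have "to_nat_on D K \<in> J" "k (to_nat_on D K) = K"
        using D(1) by (auto simp: J_def k_def)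
      then show "x \<in> (\<Union>n\<in>J. {c n..d n})" using cd K by blast
    qed
    show "c n < d n" "T \<inter> {c n..d n} \<noteq> {}" if "n \<in> J" for n
      using cd[OF that] D(4)[OF kD[OF that]] by auto
  qed (rule s)
qed

lemma null_set_if_linear_ball_growth:
  assumes M: "sets M = sets circle_borel" "finite_measure M"
    and Z: "Z \<in> null_sets circle_lebesgue"
    and gr: "\<And>z r. z \<in> Z \<Longrightarrow> r > 0 \<Longrightarrow> measure M (cball z r \<inter> sphere 0 1) \<le> K * r"
  shows "Z \<in> null_sets M"
proof -
  interpret finite_measure M by (rule M(2))
  have sZ: "Z \<in> sets circle_borel"
    using Z by (auto simp: circle_lebesgue_def null_sets_def)
  have Zs: "Z \<subseteq> sphere 0 1"
    using sets.sets_into_space[OF sZ] by (subst (asm) space_restrict_space) auto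
  define T where "T = cis -` Z \<inter> {0..<2 * pi}"
  have T0: "T \<in> null_sets lborel"
    using emeasure_circle_lebesgue[OF sZ] Z by (auto simp: T_def null_sets_def)
  have "emeasure M Z \<le> 0"
  proof (rule ennreal_le_epsilon)
    fix e :: real assume e: "e > 0"
    \<comment> \<open>Positive whatever the sign of \<open>K\<close>, so that \<open>e / K'\<close>
      is a legitimate total length.\<close>
    define K' where "K' = \<bar>K\<bar> + 1"
    have K': "K' > 0" "K \<le> K'" by (auto simp: K'_def)
    have TT: "T \<subseteq> {0..2 * pi}" "0 < 2 * pi" "0 < e / K'" using e K' by (auto simp: T_def)
    obtain c d :: "nat \<Rightarrow> real" and J where J: "T \<subseteq> (\<Union>n\<in>J. {c n..d n})"
      "\<forall>n\<in>J. c n < d n \<and> T \<inter> {c n..d n} \<noteq> {}"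
      "(\<Sum>n. if n \<in> J then ennreal (d n - c n) else 0) \<le> ennreal (e / K')"
      using null_set_cover_intervals[OF TT(1,2) T0 TT(3)] by (elim exE conjE)
    \<comment> \<open>A point of \<open>T\<close> in each interval becomes the centre of a ball
      whose radius is the length of the interval; the ball contains the arc because
      \<open>cis\<close> is 1-Lipschitz.\<close>
    define x where "x n = (SOME x. x \<in> T \<inter> {c n..d n})" for n
    have x: "x n \<in> T \<inter> {c n..d n}" if "n \<in> J" for n
      unfolding x_def some_in_eq using J(2) that by blast
    define A where "A n = (if n \<in> J then cball (cis (x n)) (d n - c n) \<inter> sphere 0 1 else {})" for n
    have mb: "cball z r \<inter> sphere 0 1 \<in> sets M" for z r
      unfolding M(1) sets_restrict_space by (rule image_eqI[of _ _ "cball z r"]) auto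
    have A: "A n \<in> sets M" for n using mb by (simp add: A_def)
    have "Z \<subseteq> (\<Union>n. A n)"
    proof
      fix z assume z: "z \<in> Z"
      then have z1: "cmod z = 1" using Zs by auto
      then obtain t where t: "0 \<le> t" "t < 2 * pi" "z = cis t" by (rule circle_eq_cis)
      then have "t \<in> T" using z by (auto simp: T_def)
      then obtain n where n: "n \<in> J" "t \<in> {c n..d n}" using J(1) by blast
      have "dist (cis (x n)) z \<le> \<bar>x n - t\<bar>" unfolding t(3) by (rule dist_cis_le)
      also have "\<dots> \<le> d n - c n" using n x[OF n(1)] by auto
      finally have "z \<in> A n" using n z1 by (simp add: A_def)
      then show "z \<in> (\<Union>n. A n)" by blast
    qed
    then have "emeasure M Z \<le> emeasure M (\<Union>n. A n)" using A by (intro emeasure_mono) auto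
    also have "\<dots> \<le> (\<Sum>n. emeasure M (A n))" using A by (intro emeasure_subadditive_countably) auto
    also have "\<dots> \<le> (\<Sum>n. ennreal K' * (if n \<in> J then ennreal (d n - c n) else 0))"
    proof (intro suminf_le summableI)
      fix n show "emeasure M (A n) \<le> ennreal K' * (if n \<in> J then ennreal (d n - c n) else 0)"
      proof (cases "n \<in> J")
        case True
        have "cis (x n) \<in> Z" using x[OF True] by (auto simp: T_def)
        moreover have dc: "0 < d n - c n" using bspec[OF J(2) True] by simp
        ultimately have "measure M (A n) \<le> K * (d n - c n)" using gr True by (simp add: A_def)
        also have "\<dots> \<le> K' * (d n - c n)" using K' dc by (intro mult_right_mono) auto
        finally have "ennreal (measure M (A n)) \<le> ennreal K' * ennreal (d n - c n)"
          using K' dc by (simp add: ennreal_mult[symmetric] ennreal_leI)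
        then show ?thesis using True by (simp add: emeasure_eq_measure)
      qed (simp add: A_def)
    qed
    also have "\<dots> = ennreal K' * (\<Sum>n. if n \<in> J then ennreal (d n - c n) else 0)"
      by (rule ennreal_suminf_cmult)
    also have "\<dots> \<le> ennreal K' * ennreal (e / K')" by (intro mult_left_mono J(3)) simp
    also have "\<dots> = ennreal e" using K' e by (simp add: ennreal_mult[symmetric])
    finally show "emeasure M Z \<le> 0 + ennreal e" by simp
  qed
  then show ?thesis using sZ M(1) by (auto simp: null_sets_def)
qed

section \<open>The singular part as a restriction of the measure\<close>

text \<open>Exhaustion: the union of \<open>L\<close>-null sets whose \<open>M\<close>-masses
  approach the supremum attains it, and an \<open>L\<close>-null set with mass outside would push
  beyond it.\<close>

lemma maximal_null_set:
  assumes "finite_measure M" "sets L = sets M"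
  obtains E where "E \<in> null_sets L" "\<And>A. A \<in> null_sets L \<Longrightarrow> A - E \<in> null_sets M"
proof -
  interpret finite_measure M by (rule assms(1))
  define s where "s = (SUP E\<in>null_sets L. measure M E)"
  have bdd: "bdd_above (measure M ` null_sets L)"
    by (rule bdd_aboveI[of _ "measure M (space M)"]) (auto intro: bounded_measure)
  have ne: "null_sets L \<noteq> {}" by blast
  have "\<exists>E\<in>null_sets L. s - 1 / real (Suc n) < measure M E" for n
    using less_cSUP_iff[OF ne bdd, of "s - 1 / real (Suc n)"] by (simp add: s_def)
  then obtain F where F: "\<And>n. F n \<in> null_sets L" "\<And>n. s - 1 / real (Suc n) < measure M (F n)" by metis
  define E where "E = (\<Union>n. F n)"
  have E: "E \<in> null_sets L" unfolding E_def using F(1) by (rule null_sets_UN)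
  have sE: "E \<in> sets M" using E assms(2) by auto
  have "s - 1 / real (Suc n) \<le> measure M E" for n
  proof -
    have "measure M (F n) \<le> measure M E"
      using sE by (intro finite_measure_mono) (auto simp: E_def)
    then show ?thesis using F(2)[of n] by linarith
  qed
  moreover have "(\<lambda>n. s - 1 / real (Suc n)) \<longlonglongrightarrow> s - 0"
    by (intro tendsto_diff tendsto_const LIMSEQ_Suc lim_1_over_n)
  ultimately have sle: "s \<le> measure M E" by (intro LIMSEQ_le_const2[of _ s]) auto
  show ?thesis
  proof (rule that[OF E])
    fix A assume A: "A \<in> null_sets L"
    then have sA: "A \<in> sets M" using assms(2) by auto
    have "measure M (E \<union> A) \<le> s"
      unfolding s_def using E A by (intro cSUP_upper bdd) auto
    moreover have "measure M (E \<union> A) = measure M E + measure M (A - E)"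
      using sE sA by (rule finite_measure_Union')
    ultimately have "measure M (A - E) \<le> 0" using sle by linarith
    then have "measure M (A - E) = 0" by (simp add: measure_le_0_iff)
    then show "A - E \<in> null_sets M" using sA sE by (auto simp: null_sets_def emeasure_eq_measure)
  qed
qed

text \<open>\<open>K\<close> ignores \<open>F\<close> and \<open>N\<close> lives inside it. Since
  \<open>F\<close> may exceed \<open>E\<close>, two decompositions can be compared on the union of
  their carriers.\<close>

lemma emeasure_singular_component:
  assumes "sets N = sets M" "sets K = sets M" "absolutely_continuous L K" "F \<in> null_sets L"
    "E \<in> null_sets L" "supported_by N E" "E \<subseteq> F" "sets L = sets M"
    and dec: "\<forall>A\<in>sets M. emeasure M A = emeasure K A + emeasure N A" and A: "A \<in> sets M"
  shows "emeasure N A = emeasure M (A \<inter> F)"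
proof -
  have F: "F \<in> sets M" using assms by auto
  have "F \<in> null_sets K" using assms by (auto simp: absolutely_continuous_def)
  then have "emeasure K (A \<inter> F) = 0" using A assms by (metis Int_commute null_setsD1 null_set_Int2)
  moreover have "A - F \<in> null_sets N"
  proof (rule null_sets_subset)
    show "space N - E \<in> null_sets N" using assms by (simp add: supported_by_def)
    show "A - F \<in> sets N" "A - F \<subseteq> space N - E"
      using A F assms sets.sets_into_space[OF A] sets_eq_imp_space_eq[OF assms(1)] by auto
  qed
  ultimately have "emeasure M (A \<inter> F) = emeasure N (A \<inter> F)" using A F dec by simp
  also have "\<dots> = emeasure N (A \<inter> F) + emeasure N (A - F)"
    using null_setsD1[OF \<open>A - F \<in> null_sets N\<close>] by simp
  also have "\<dots> = emeasure N A"
    using A F assms by (subst plus_emeasure) (auto simp: Int_Diff_Un)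
  finally show ?thesis ..
qed

text \<open>\<open>singular_part\<close> is a definite description, so existence and uniqueness must
  be settled before it has any property.\<close>

lemma singular_part_eq_restriction:
  assumes fin: "finite_measure M" and sL: "sets L = sets M"
  obtains E where "E \<in> null_sets L" "singular_part L M = density M (indicator E)"
proof -
  obtain E where E: "E \<in> null_sets L" "\<And>A. A \<in> null_sets L \<Longrightarrow> A - E \<in> null_sets M"
    using maximal_null_set[OF assms] by blast
  have sE: "E \<in> sets M" using E(1) sL by auto
  define N where "N = density M (indicator E)"
  define K where "K = density M (indicator (space M - E))"
  have eN: "emeasure N A = emeasure M (E \<inter> A)" if "A \<in> sets M" for A
    unfolding N_def using sE that by (rule emeasure_restricted)
  have eK: "emeasure K A = emeasure M ((space M - E) \<inter> A)" if "A \<in> sets M" for A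
    unfolding K_def using sE that by (intro emeasure_restricted) auto
  have sK: "sets K = sets M" and sN: "sets N = sets M" by (simp_all add: K_def N_def)
  \<comment> \<open>Maximality of \<open>E\<close> is exactly what makes the remainder absolutely
    continuous.\<close>
  have acK: "absolutely_continuous L K"
    unfolding absolutely_continuous_def
  proof
    fix A assume A: "A \<in> null_sets L"
    then have sA: "A \<in> sets M" using sL by auto
    then have "(space M - E) \<inter> A = A - E" using sets.sets_into_space by auto
    then show "A \<in> null_sets K" using eK[OF sA] E(2)[OF A] sA sK by (auto simp: null_sets_def)
  qed
  have suN: "supported_by N E"
    unfolding supported_by_def null_sets_def
    using eN[of "space M - E"] sE sN by (auto simp: N_def)
  have dec: "\<forall>A\<in>sets M. emeasure M A = emeasure K A + emeasure N A"
  proof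
    fix A assume A: "A \<in> sets M"
    have "emeasure K A + emeasure N A = emeasure M ((space M - E) \<inter> A \<union> E \<inter> A)"
      unfolding eN[OF A] eK[OF A] using A sE by (intro plus_emeasure) auto
    also have "(space M - E) \<inter> A \<union> E \<inter> A = A" using sets.sets_into_space[OF A] by auto
    finally show "emeasure M A = emeasure K A + emeasure N A" ..
  qed
  have "singular_part L M = N"
    unfolding singular_part_def
  proof (rule the_equality)
    show "sets N = sets M \<and> mutually_singular L N \<and> (\<exists>K. sets K = sets M \<and> absolutely_continuous L K \<and>
          (\<forall>A\<in>sets M. emeasure M A = emeasure K A + emeasure N A))"
      using sN sK acK dec suN E(1) unfolding mutually_singular_def by blast
    fix N' assume "sets N' = sets M \<and> mutually_singular L N' \<and> (\<exists>K. sets K = sets M \<and> absolutely_continuous L K \<and>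
          (\<forall>A\<in>sets M. emeasure M A = emeasure K A + emeasure N' A))"
    then obtain K' E' where N': "sets N' = sets M" "E' \<in> null_sets L" "supported_by N' E'" "sets K' = sets M"
        "absolutely_continuous L K'" "\<forall>A\<in>sets M. emeasure M A = emeasure K' A + emeasure N' A"
      unfolding mutually_singular_def by blast
    have F: "E \<union> E' \<in> null_sets L" using E(1) N'(2) by (rule null_sets.Un)
    show "N' = N"
    proof (rule measure_eqI)
      fix A assume "A \<in> sets N'"
      then have A: "A \<in> sets M" using N' by simp
      show "emeasure N' A = emeasure N A"
        using emeasure_singular_component[OF N'(1,4,5) F N'(2,3) _ sL N'(6) A]
          emeasure_singular_component[OF sN sK acK F E(1) suN _ sL dec A] by simp
    qed (use N' sN in simp)
  qed
  then show ?thesis using that E(1) unfolding N_def by blast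
qed

text \<open>The carrier of the singular part is \<open>L\<close>-null, hence so is its part off
  \<open>S\<close>, which \<open>null\<close> then makes \<open>M\<close>-null.\<close>

lemma supported_by_singular_part:
  assumes fin: "finite_measure M" and sL: "sets L = sets M" and S: "space M - S \<in> sets M"
    and null: "\<And>Z. Z \<in> null_sets L \<Longrightarrow> Z \<subseteq> space M - S \<Longrightarrow> Z \<in> null_sets M"
  shows "supported_by (singular_part L M) S"
proof -
  obtain E where E: "E \<in> null_sets L" "singular_part L M = density M (indicator E)"
    using singular_part_eq_restriction[OF fin sL] .
  have sE: "E \<in> sets M" using E(1) sL by auto
  have "E \<inter> (space M - S) \<in> null_sets L"
    using E(1) S sL by (intro null_set_Int2) auto
  then have "E \<inter> (space M - S) \<in> null_sets M" by (rule null) auto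
  moreover have "emeasure (density M (indicator E)) (space M - S) = emeasure M (E \<inter> (space M - S))"
    using sE S by (rule emeasure_restricted)
  ultimately show ?thesis
    unfolding supported_by_def E(2) null_sets_def using S by (auto simp: space_density)
qed

section \<open>Orthogonal polynomials on the unit circle\<close>

lemma poly_szego_dual_circle:
  assumes "cmod z = 1"
  shows "poly (szego_dual p) z = z ^ degree p * cnj (poly p z)"
proof -
  have "z \<noteq> 0" using assms by auto
  moreover from this have e: "1 / cnj z = z"
    using cnj_mult_power_self(1)[OF assms] by (simp add: field_simps)
  ultimately show ?thesis by (subst poly_szego_dual) (simp_all only: e not_False_eq_True)
qed

lemma poly_second_kind_circle:
  assumes z: "cmod z = 1" and \<alpha>: "\<forall>n. cmod (\<alpha> n) < 1"
  shows "poly (second_kind \<alpha> n) z = szego_rec (\<lambda>n. - \<alpha> n) z n"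
proof (induction n)
  case (Suc n)
  show ?case
    using degree_second_kind[OF \<alpha>, of n]
    by (simp add: poly_szego_dual_circle[OF z] Suc)
qed simp

section \<open>Inner product, Szego recursion and Verblunsky coefficients of a fixed measure\<close>

locale circle_prob =
  fixes M :: "complex measure"
  assumes nontrivial: "nontrivial_circle_prob M"
begin

lemma sets_M: "sets M = sets circle_borel"
  and prob: "prob_space M"
  using nontrivial by (auto simp: nontrivial_circle_prob_def)

sublocale prob_space M by (rule prob)

lemma integrable_continuous:
  fixes h :: "complex \<Rightarrow> 'b::{banach, second_countable_topology}"
  shows "continuous_on UNIV h \<Longrightarrow> integrable M h"
  using integrable_circle[OF sets_M finite_measure_axioms] .

lemma integrable_poly_product [simp]: "integrable M (\<lambda>z. cnj (poly p z) * poly q z)"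
  by (intro integrable_continuous continuous_intros)

lemma l2_inner_add_right: "l2_inner M p (q + r) = l2_inner M p q + l2_inner M p r"
  unfolding l2_inner_def poly_add distrib_left by (rule Bochner_Integration.integral_add) simp_all

lemma l2_inner_smult_right: "l2_inner M p (smult c q) = c * l2_inner M p q"
  unfolding l2_inner_def by (simp add: mult.left_commute)

lemma l2_inner_zero_right [simp]: "l2_inner M p 0 = 0"
  by (simp add: l2_inner_def)

lemma l2_inner_diff_right: "l2_inner M p (q - r) = l2_inner M p q - l2_inner M p r"
  using l2_inner_add_right[of p q "smult (- 1) r"] by (simp only: l2_inner_smult_right) simp

lemma l2_inner_sum_right: "l2_inner M p (\<Sum>i\<in>I. q i) = (\<Sum>i\<in>I. l2_inner M p (q i))"
  by (induction I rule: infinite_finite_induct) (simp_all add: l2_inner_add_right)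

lemma l2_inner_cnj: "cnj (l2_inner M p q) = l2_inner M q p"
proof -
  have "cnj (l2_inner M p q) = (LINT z|M. cnj (cnj (poly p z) * poly q z))"
    unfolding l2_inner_def by (rule Bochner_Integration.integral_cnj[symmetric])
  then show ?thesis by (simp add: l2_inner_def mult.commute)
qed

lemma l2_inner_smult_left: "l2_inner M (smult c p) q = cnj c * l2_inner M p q"
  by (subst (1 2) l2_inner_cnj[symmetric]) (simp add: l2_inner_smult_right)

lemma l2_inner_add_left: "l2_inner M (p + q) r = l2_inner M p r + l2_inner M q r"
  by (subst (1 2 3) l2_inner_cnj[symmetric]) (simp add: l2_inner_add_right)

lemma l2_inner_sum_left: "l2_inner M (\<Sum>i\<in>I. q i) p = (\<Sum>i\<in>I. l2_inner M (q i) p)"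
  by (subst (1 2) l2_inner_cnj[symmetric]) (simp add: l2_inner_sum_right)

lemma l2_inner_self: "l2_inner M p p = complex_of_real ((l2_norm M p)\<^sup>2)"
proof -
  have "l2_inner M p p = (LINT z|M. complex_of_real ((cmod (poly p z))\<^sup>2))"
    unfolding l2_inner_def complex_norm_square by (simp only: mult.commute)
  also have "\<dots> = complex_of_real (LINT z|M. (cmod (poly p z))\<^sup>2)" by (rule integral_complex_of_real)
  finally show ?thesis by (simp add: l2_norm_def)
qed

text \<open>Nontriviality enters here: a nonzero polynomial of norm 0 would put all mass on its
  finitely many roots.\<close>

lemma l2_inner_self_eq_0_iff: "l2_inner M p p = 0 \<longleftrightarrow> p = 0"
proof
  assume "l2_inner M p p = 0"
  then have "(LINT z|M. (cmod (poly p z))\<^sup>2) = 0"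
    unfolding l2_inner_self by (simp add: l2_norm_def)
  moreover have "integrable M (\<lambda>z. (cmod (poly p z))\<^sup>2)"
    by (intro integrable_continuous continuous_intros)
  ultimately have AE: "AE z in M. poly p z = 0"
    using integral_nonneg_eq_0_iff_AE[of M "\<lambda>z. (cmod (poly p z))\<^sup>2"] by simp
  show "p = 0"
  proof (rule ccontr)
    assume "p \<noteq> 0"
    then have fin: "finite {z. poly p z = 0}" by (rule poly_roots_finite)
    have "space M - {z. poly p z = 0} = (- {z. poly p z = 0}) \<inter> sphere 0 1"
      unfolding space_circle[OF sets_M] by auto
    moreover have "- {z. poly p z = 0} \<in> sets borel"
      using finite_imp_closed[OF fin] by auto
    ultimately have s: "space M - {z. poly p z = 0} \<in> sets M"
      unfolding sets_M sets_restrict_space by (auto simp: image_iff)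
    have "{z \<in> space M. \<not> poly p z = 0} = space M - {z. poly p z = 0}" by auto
    then have "emeasure M (space M - {z. poly p z = 0}) = 0"
      using AE_iff_measurable[of "space M - {z. poly p z = 0}" M "\<lambda>z. poly p z = 0"] s AE by simp
    then have "supported_by M {z. poly p z = 0}"
      using s by (simp add: supported_by_def null_sets_def)
    then show False using nontrivial fin unfolding nontrivial_circle_prob_def by blast
  qed
qed (simp add: l2_inner_def)

abbreviation \<Phi> where "\<Phi> \<equiv> monic_op M"

lemma coeff_monic_op: "coeff (\<Phi> n) n = 1 \<and> (\<forall>i>n. coeff (\<Phi> n) i = 0)"
proof (induction n rule: less_induct)
  case (less n)
  have "coeff (\<Phi> n) i = coeff (monom 1 n) i" if "i \<ge> n" for i
    using less that by (subst monic_op.simps) (auto simp: coeff_sum intro!: sum.neutral)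
  then show ?case by simp
qed

lemma degree_monic_op [simp]: "degree (\<Phi> n) = n"
  using coeff_monic_op[of n] by (intro antisym le_degree degree_le) auto

lemma monic_op_nonzero [simp]: "\<Phi> n \<noteq> 0"
  using coeff_monic_op[of n] by auto

lemma l2_norm_monic_op_pos: "l2_norm M (\<Phi> n) > 0"
proof -
  have "l2_norm M (\<Phi> n) \<noteq> 0" using l2_inner_self_eq_0_iff[of "\<Phi> n"] l2_inner_self[of "\<Phi> n"] by auto
  moreover have "l2_norm M (\<Phi> n) \<ge> 0" by (simp add: l2_norm_def)
  ultimately show ?thesis by simp
qed

lemma monic_op_orthogonal_less: "k < n \<Longrightarrow> l2_inner M (\<Phi> k) (\<Phi> n) = 0"
proof (induction n arbitrary: k rule: less_induct)
  case (less n)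
  define c where "c j = l2_inner M (\<Phi> j) (monom 1 n) / l2_inner M (\<Phi> j) (\<Phi> j)" for j
  have "l2_inner M (\<Phi> k) (\<Phi> n) = l2_inner M (\<Phi> k) (monom 1 n) - (\<Sum>j<n. c j * l2_inner M (\<Phi> k) (\<Phi> j))"
    by (subst (2) monic_op.simps)
      (simp add: l2_inner_diff_right l2_inner_sum_right l2_inner_smult_right c_def)
  also have "(\<Sum>j<n. c j * l2_inner M (\<Phi> k) (\<Phi> j)) = (\<Sum>j<n. if k = j then c j * l2_inner M (\<Phi> k) (\<Phi> j) else 0)"
  proof (rule sum.cong[OF refl])
    fix j assume j: "j \<in> {..<n}"
    consider "k < j" | "j < k" | "k = j" by linarith
    then show "c j * l2_inner M (\<Phi> k) (\<Phi> j) = (if k = j then c j * l2_inner M (\<Phi> k) (\<Phi> j) else 0)"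
    proof cases
      case 1 then show ?thesis using less j by simp
    next
      case 2
      then have "l2_inner M (\<Phi> j) (\<Phi> k) = 0" using less by simp
      then show ?thesis using 2 l2_inner_cnj[of "\<Phi> j" "\<Phi> k"] by simp
    qed simp
  qed
  also have "\<dots> = c k * l2_inner M (\<Phi> k) (\<Phi> k)" using less.prems by (simp add: sum.delta)
  also have "\<dots> = l2_inner M (\<Phi> k) (monom 1 n)"
    using l2_inner_self_eq_0_iff[of "\<Phi> k"] by (simp add: c_def)
  finally show ?case by simp
qed

lemma monic_op_orthogonal: "k \<noteq> n \<Longrightarrow> l2_inner M (\<Phi> k) (\<Phi> n) = 0"
  using monic_op_orthogonal_less[of k n] monic_op_orthogonal_less[of n k] l2_inner_cnj[of "\<Phi> n" "\<Phi> k"]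
  by (cases k n rule: linorder_cases) auto

text \<open>Bounding the degree through coefficients lets \<open>m = 0\<close> mean
  \<open>p = 0\<close>, the base case; the step peels off a multiple of
  \<open>\<Phi> m\<close>.\<close>

lemma monic_op_orthogonal_lower:
  assumes "\<And>i. i \<ge> m \<Longrightarrow> coeff p i = 0" "m \<le> n"
  shows "l2_inner M p (\<Phi> n) = 0"
  using assms
proof (induction m arbitrary: p)
  case 0
  then have "p = 0" by (intro poly_eqI) simp
  then show ?case by (simp add: l2_inner_def)
next
  case (Suc m)
  define q where "q = p - smult (coeff p m) (\<Phi> m)"
  have "l2_inner M q (\<Phi> n) = 0"
  proof (rule Suc.IH)
    fix i assume "m \<le> i"
    then show "coeff q i = 0"
      using Suc.prems(1)[of i] coeff_monic_op[of m] by (cases "i = m") (auto simp: q_def)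
  qed (use Suc.prems in simp)
  moreover have "p = q + smult (coeff p m) (\<Phi> m)" by (simp add: q_def)
  ultimately have "l2_inner M p (\<Phi> n) = cnj (coeff p m) * l2_inner M (\<Phi> m) (\<Phi> n)"
    by (metis add_0 l2_inner_add_left l2_inner_smult_left)
  then show ?case using monic_op_orthogonal_less[of m n] Suc.prems by simp
qed

lemma l2_inner_cong_circle:
  assumes "\<And>z. cmod z = 1 \<Longrightarrow> cnj (poly p z) * poly q z = cnj (poly p' z) * poly q' z"
  shows "l2_inner M p q = l2_inner M p' q'"
  unfolding l2_inner_def by (rule Bochner_Integration.integral_cong) (simp_all add: space_circle[OF sets_M] assms)

lemma l2_inner_pCons_pCons: "l2_inner M (pCons 0 p) (pCons 0 q) = l2_inner M p q"
proof (rule l2_inner_cong_circle)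
  fix z :: complex assume "cmod z = 1"
  then have "z * cnj z = 1" by (rule cnj_mult_power_self)
  moreover have "cnj (poly (pCons 0 p) z) * poly (pCons 0 q) z = (z * cnj z) * (cnj (poly p z) * poly q z)"
    by simp
  ultimately show "cnj (poly (pCons 0 p) z) * poly (pCons 0 q) z = cnj (poly p z) * poly q z" by simp
qed

text \<open>On the circle, duality reverses exponents: the claim becomes orthogonality of
  \<open>\<Phi> n\<close> to \<open>z ^ (n - j)\<close>, of degree below \<open>n\<close> because
  \<open>j \<ge> 1\<close>.\<close>

lemma l2_inner_monom_szego_dual:
  assumes "1 \<le> j" "j \<le> n"
  shows "l2_inner M (monom 1 j) (szego_dual (\<Phi> n)) = 0"
proof -
  have "l2_inner M (monom 1 j) (szego_dual (\<Phi> n)) = l2_inner M (\<Phi> n) (monom 1 (n - j))"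
  proof (rule l2_inner_cong_circle)
    fix z :: complex assume z: "cmod z = 1"
    have "z ^ n = z ^ (n - j) * z ^ j" using assms by (simp flip: power_add)
    then have "cnj (poly (monom 1 j) z) * poly (szego_dual (\<Phi> n)) z =
        (z ^ j * cnj z ^ j) * (cnj (poly (\<Phi> n) z) * z ^ (n - j))"
      by (simp add: poly_szego_dual_circle[OF z] poly_monom)
    then show "cnj (poly (monom 1 j) z) * poly (szego_dual (\<Phi> n)) z = cnj (poly (\<Phi> n) z) * poly (monom 1 (n - j)) z"
      by (simp only: cnj_mult_power_self(2)[OF z] poly_monom mult_1)
  qed
  also have "\<dots> = cnj (l2_inner M (monom 1 (n - j)) (\<Phi> n))" by (rule l2_inner_cnj[symmetric])
  also have "l2_inner M (monom 1 (n - j)) (\<Phi> n) = 0"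
    using assms by (intro monic_op_orthogonal_lower[of n]) auto
  finally show ?thesis by simp
qed

lemma coeff_szego_dual_monic_op:
  "coeff (szego_dual (\<Phi> n)) 0 = 1" "i > n \<Longrightarrow> coeff (szego_dual (\<Phi> n)) i = 0"
  using coeff_monic_op[of n] by (simp_all add: coeff_szego_dual)

text \<open>The difference of both sides has no constant coefficient, has degree at most \<open>n\<close> and is
  orthogonal to \<open>z, \<dots>, z^n\<close>.\<close>
lemma szego_recursion:
  obtains c where "\<Phi> (Suc n) = pCons 0 (\<Phi> n) + smult c (szego_dual (\<Phi> n))"
proof -
  define D where "D = \<Phi> (Suc n) - pCons 0 (\<Phi> n)"
  define R where "R = D - smult (coeff D 0) (szego_dual (\<Phi> n))"
  have D: "coeff D i = 0" if "i > n" for i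
    using that coeff_monic_op[of n] coeff_monic_op[of "Suc n"]
    by (cases i; cases "i = Suc n") (auto simp: D_def)
  have R0: "coeff R 0 = 0" by (simp add: R_def coeff_szego_dual_monic_op)
  have Ri: "coeff R i = 0" if "i > n" for i
    using D[OF that] coeff_szego_dual_monic_op(2)[OF that] by (simp add: R_def)
  have orth: "l2_inner M (monom 1 j) R = 0" if "1 \<le> j" "j \<le> n" for j
  proof -
    have "l2_inner M (monom 1 j) (\<Phi> (Suc n)) = 0"
      using that by (intro monic_op_orthogonal_lower[of "Suc n"]) auto
    moreover have "monom 1 j = pCons 0 (monom 1 (j - 1) :: complex poly)"
      using that by (simp flip: monom_Suc)
    then have "l2_inner M (monom 1 j) (pCons 0 (\<Phi> n)) = l2_inner M (monom 1 (j - 1)) (\<Phi> n)"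
      by (simp only: l2_inner_pCons_pCons)
    moreover have "\<dots> = 0"
      using that by (intro monic_op_orthogonal_lower[of n]) auto
    ultimately show ?thesis
      using l2_inner_monom_szego_dual[OF that]
      by (simp add: R_def D_def l2_inner_diff_right l2_inner_smult_right)
  qed
  have "R = (\<Sum>i\<le>n. monom (coeff R i) i)"
    by (rule poly_eqI) (use Ri in \<open>auto simp: coeff_sum not_le\<close>)
  also have "\<dots> = (\<Sum>i\<le>n. smult (coeff R i) (monom 1 i))" by (simp add: smult_monom)
  finally have "l2_inner M R R = l2_inner M (\<Sum>i\<le>n. smult (coeff R i) (monom 1 i)) R" by (rule arg_cong)
  also have "\<dots> = (\<Sum>i\<le>n. cnj (coeff R i) * l2_inner M (monom 1 i) R)"
    by (simp add: l2_inner_sum_left l2_inner_smult_left)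
  also have "\<dots> = 0"
  proof (rule sum.neutral, rule ballI)
    fix i assume "i \<in> {..n}"
    then show "cnj (coeff R i) * l2_inner M (monom 1 i) R = 0"
      using R0 orth[of i] by (cases "i = 0") auto
  qed
  finally have "R = 0" by (simp only: l2_inner_self_eq_0_iff)
  then have "\<Phi> (Suc n) = pCons 0 (\<Phi> n) + smult (coeff D 0) (szego_dual (\<Phi> n))"
    by (simp add: R_def D_def algebra_simps)
  then show ?thesis by (rule that)
qed

lemma l2_inner_szego_dual_self: "l2_inner M (szego_dual p) (szego_dual p) = l2_inner M p p"
proof (rule l2_inner_cong_circle)
  fix z :: complex assume z: "cmod z = 1"
  have "cnj (poly (szego_dual p) z) * poly (szego_dual p) z =
      (z ^ degree p * cnj z ^ degree p) * (cnj (poly p z) * poly p z)"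
    by (simp add: poly_szego_dual_circle[OF z])
  then show "cnj (poly (szego_dual p) z) * poly (szego_dual p) z = cnj (poly p z) * poly p z"
    by (simp only: cnj_mult_power_self(2)[OF z] mult_1)
qed

text \<open>Pythagoras: \<open>\<Phi> (Suc n)\<close> is orthogonal to the dual, which has degree at
  most \<open>n\<close>, while shift and dual both preserve the norm.\<close>

lemma szego_recursion_norm:
  assumes "\<Phi> (Suc n) = pCons 0 (\<Phi> n) + smult c (szego_dual (\<Phi> n))"
  shows "(l2_norm M (\<Phi> (Suc n)))\<^sup>2 = (1 - (cmod c)\<^sup>2) * (l2_norm M (\<Phi> n))\<^sup>2"
proof -
  define S where "S = szego_dual (\<Phi> n)"
  have "l2_inner M S (\<Phi> (Suc n)) = 0"
    using coeff_szego_dual_monic_op(2) unfolding S_def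
    by (intro monic_op_orthogonal_lower[of "Suc n"]) auto
  then have SP: "l2_inner M S (pCons 0 (\<Phi> n)) = - c * l2_inner M S S"
    unfolding assms S_def[symmetric] by (simp add: l2_inner_add_right l2_inner_smult_right add_eq_0_iff)
  then have PS: "l2_inner M (pCons 0 (\<Phi> n)) S = - cnj c * cnj (l2_inner M S S)"
    using l2_inner_cnj[of S "pCons 0 (\<Phi> n)"] by simp
  have "l2_inner M (\<Phi> (Suc n)) (\<Phi> (Suc n)) =
     l2_inner M (\<Phi> n) (\<Phi> n) + c * l2_inner M (pCons 0 (\<Phi> n)) S + cnj c * l2_inner M S (pCons 0 (\<Phi> n)) + c * cnj c * l2_inner M S S"
    unfolding assms S_def[symmetric]
    by (simp add: l2_inner_add_right l2_inner_add_left l2_inner_smult_left l2_inner_smult_right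
        l2_inner_pCons_pCons algebra_simps)
  also have "\<dots> = (1 - c * cnj c) * l2_inner M (\<Phi> n) (\<Phi> n)"
    unfolding SP PS l2_inner_cnj by (simp add: S_def l2_inner_szego_dual_self algebra_simps)
  finally have "complex_of_real ((l2_norm M (\<Phi> (Suc n)))\<^sup>2) = complex_of_real ((1 - (cmod c)\<^sup>2) * (l2_norm M (\<Phi> n))\<^sup>2)"
    unfolding l2_inner_self of_real_mult of_real_diff complex_norm_square[of c] by simp
  then show ?thesis unfolding of_real_eq_iff .
qed

text \<open>A positive norm of \<open>\<Phi> (Suc n)\<close> forces the modulus below 1. Uniqueness
  is read off the constant coefficient, which is 1 for the dual and 0 for the shift.\<close>

lemma verblunsky:
  shows "cmod (verblunsky M n) < 1"
    and "\<Phi> (Suc n) = pCons 0 (\<Phi> n) - smult (cnj (verblunsky M n)) (szego_dual (\<Phi> n))"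
proof -
  obtain c where c: "\<Phi> (Suc n) = pCons 0 (\<Phi> n) + smult c (szego_dual (\<Phi> n))" by (rule szego_recursion)
  have "0 < (1 - (cmod c)\<^sup>2) * (l2_norm M (\<Phi> n))\<^sup>2"
    unfolding szego_recursion_norm[OF c, symmetric] using l2_norm_monic_op_pos[of "Suc n"] by simp
  then have "(cmod c)\<^sup>2 < 1" by (simp add: zero_less_mult_iff)
  then have c1: "cmod c < 1" by (simp add: power_less_one_iff)
  let ?P = "\<lambda>a. cmod a < 1 \<and> \<Phi> (Suc n) = pCons 0 (\<Phi> n) - smult (cnj a) (szego_dual (\<Phi> n))"
  have "?P (- cnj c)" using c c1 by simp
  moreover have "a = - cnj c" if "?P a" for a
  proof -
    have "pCons 0 (\<Phi> n) - smult (cnj a) (szego_dual (\<Phi> n)) = pCons 0 (\<Phi> n) + smult c (szego_dual (\<Phi> n))"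
      using that c by simp
    then have "coeff (pCons 0 (\<Phi> n) - smult (cnj a) (szego_dual (\<Phi> n))) 0 =
        coeff (pCons 0 (\<Phi> n) + smult c (szego_dual (\<Phi> n))) 0" by (rule arg_cong)
    then have "- cnj a = c"
      by (simp only: coeff_diff coeff_add coeff_pCons_0 coeff_smult coeff_szego_dual_monic_op) simp
    then show ?thesis by auto
  qed
  ultimately have "?P (verblunsky M n)" unfolding verblunsky_def by (rule theI)
  then show "cmod (verblunsky M n) < 1"
    and "\<Phi> (Suc n) = pCons 0 (\<Phi> n) - smult (cnj (verblunsky M n)) (szego_dual (\<Phi> n))" by auto
qed

lemma l2_norm_monic_op_Suc:
  "l2_norm M (\<Phi> (Suc n)) = sqrt (1 - (cmod (verblunsky M n))\<^sup>2) * l2_norm M (\<Phi> n)"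
proof -
  have "\<Phi> (Suc n) = pCons 0 (\<Phi> n) + smult (- cnj (verblunsky M n)) (szego_dual (\<Phi> n))"
    using verblunsky(2)[of n] by simp
  from szego_recursion_norm[OF this]
  have "sqrt ((l2_norm M (\<Phi> (Suc n)))\<^sup>2) = sqrt ((1 - (cmod (verblunsky M n))\<^sup>2) * (l2_norm M (\<Phi> n))\<^sup>2)" by simp
  then show ?thesis
    using l2_norm_monic_op_pos[of n] l2_norm_monic_op_pos[of "Suc n"] by (simp add: real_sqrt_mult)
qed

lemma poly_orthonormal_op_circle:
  assumes z: "cmod z = 1"
  shows "poly (orthonormal_op M n) z = szego_rec (verblunsky M) z n"
proof (induction n)
  case 0
  have "\<Phi> 0 = 1" by (subst monic_op.simps) (simp add: one_pCons monom_0)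
  then show ?case by (simp add: orthonormal_op_def l2_norm_def prob_space)
next
  case (Suc n)
  define r where "r = complex_of_real (sqrt (1 - (cmod (verblunsky M n))\<^sup>2))"
  define l where "l = complex_of_real (l2_norm M (\<Phi> n))"
  have rl: "r \<noteq> 0" "l \<noteq> 0" "cnj l = l"
    using sqrt_one_minus_norm_sq(1)[OF verblunsky(1)[of n]] l2_norm_monic_op_pos[of n] by (auto simp: r_def l_def)
  have IH: "poly (\<Phi> n) z = l * szego_rec (verblunsky M) z n"
    using Suc rl by (simp add: orthonormal_op_def l_def field_simps)
  have "poly (orthonormal_op M (Suc n)) z = poly (\<Phi> (Suc n)) z / (r * l)"
    by (simp add: orthonormal_op_def l2_norm_monic_op_Suc r_def l_def)
  also have "poly (\<Phi> (Suc n)) z = z * poly (\<Phi> n) z - cnj (verblunsky M n) * (z ^ n * cnj (poly (\<Phi> n) z))"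
    unfolding verblunsky(2) by (simp add: poly_szego_dual_circle[OF z])
  also have "\<dots> / (r * l) = (z * szego_rec (verblunsky M) z n - cnj (verblunsky M n) * z ^ n * cnj (szego_rec (verblunsky M) z n)) / r"
    unfolding IH using rl by (simp add: field_simps)
  finally show ?case by (simp add: r_def)
qed

lemma degree_orthonormal_op: "degree (orthonormal_op M n) = n"
  using l2_norm_monic_op_pos[of n] by (simp add: orthonormal_op_def)

lemma szego_rec_orthonormal:
  "(LINT w|M. cnj (szego_rec (verblunsky M) w i) * szego_rec (verblunsky M) w j) = (if i = j then 1 else 0)"
proof -
  have "(LINT w|M. cnj (szego_rec (verblunsky M) w i) * szego_rec (verblunsky M) w j) =
      l2_inner M (orthonormal_op M i) (orthonormal_op M j)"
    unfolding l2_inner_def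
    by (rule Bochner_Integration.integral_cong) (simp_all add: space_circle[OF sets_M] poly_orthonormal_op_circle)
  also have "\<dots> = l2_inner M (\<Phi> i) (\<Phi> j) / (of_real (l2_norm M (\<Phi> i)) * of_real (l2_norm M (\<Phi> j)))"
    by (simp add: orthonormal_op_def l2_inner_smult_left l2_inner_smult_right)
  also have "\<dots> = (if i = j then 1 else 0)"
  proof (cases "i = j")
    case True
    then show ?thesis using l2_norm_monic_op_pos[of j] by (simp add: l2_inner_self power2_eq_square)
  qed (simp add: monic_op_orthogonal)
  finally show ?thesis .
qed

end

section \<open>The exceptional set of a measure\<close>

text \<open>Expansion into the matrix units \<open>E p\<close>; the sum of their norms serves as
  \<open>K\<close>.\<close>

lemma matrix_norm_le_entries:
  fixes N :: "complex^'n^'m \<Rightarrow> real"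
  assumes "matrix_norm N"
  shows "\<exists>K. \<forall>X b. (\<forall>i j. cmod (X $ i $ j) \<le> b) \<longrightarrow> N X \<le> K * b"
proof -
  have N0: "\<And>X. 0 \<le> N X" and Ns: "\<And>c X. N (\<chi> i j. c * X $ i $ j) = cmod c * N X"
    and Na: "\<And>X Y. N (X + Y) \<le> N X + N Y" and Nz: "N 0 = 0"
    using assms unfolding matrix_norm_def by blast+
  have Nsum: "N (\<Sum>p\<in>P. F p) \<le> (\<Sum>p\<in>P. N (F p))" if "finite P" for P :: "('m \<times> 'n) set" and F
    using that
  proof (induction P rule: finite_induct)
    case (insert p P)
    then show ?case using Na[of "F p" "sum F P"] by simp
  qed (simp add: Nz)
  define E :: "'m \<times> 'n \<Rightarrow> complex^'n^'m" where "E p = (\<chi> i j. if p = (i, j) then 1 else 0)" for p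
  show ?thesis
  proof (intro exI[of _ "\<Sum>p\<in>UNIV. N (E p)"] allI impI)
    fix X :: "complex^'n^'m" and b
    assume b: "\<forall>i j. cmod (X $ i $ j) \<le> b"
    define F where "F p = (\<chi> i j. X $ fst p $ snd p * E p $ i $ j)" for p
    have "X = (\<Sum>p\<in>UNIV. F p)"
    proof -
      have "(\<Sum>p\<in>UNIV. F p) $ i $ j = X $ i $ j" for i j
      proof -
        have "(\<Sum>p\<in>UNIV. F p) $ i $ j = (\<Sum>p\<in>UNIV. if p = (i, j) then X $ fst p $ snd p else 0)"
          by (simp add: F_def E_def if_distrib cong: if_cong)
        then show ?thesis by (simp add: sum.delta)
      qed
      then show ?thesis by (simp add: vec_eq_iff)
    qed
    then have "N X \<le> (\<Sum>p\<in>UNIV. N (F p))" using Nsum[of UNIV F] by simp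
    also have "\<dots> \<le> (\<Sum>p\<in>UNIV. N (E p) * b)"
    proof (rule sum_mono)
      fix p :: "'m \<times> 'n"
      have "N (F p) = cmod (X $ fst p $ snd p) * N (E p)" unfolding F_def by (rule Ns)
      also have "\<dots> \<le> b * N (E p)" using b by (intro mult_right_mono N0) blast
      finally show "N (F p) \<le> N (E p) * b" by (simp add: mult.commute)
    qed
    finally show "N X \<le> (\<Sum>p\<in>UNIV. N (E p)) * b" by (simp add: sum_distrib_right)
  qed
qed

section \<open>Energy of dyadic blocks\<close>

lemma powr_le_geometric:
  fixes B \<epsilon> :: real
  assumes "B > 0" "\<epsilon> > 0"
  obtains K where "K \<ge> 0" "\<And>k::nat. (real k + 1) powr B \<le> K * (2 powr \<epsilon>) ^ k"
proof -
  \<comment> \<open>Tuned so that \<open>ln y \<le> y - 1\<close> at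
    \<open>y = \<delta> * (k + 1)\<close>, multiplied by \<open>B\<close>, has slope
    \<open>\<epsilon> * ln 2\<close> in \<open>k\<close>.\<close>
  define \<delta> where "\<delta> = \<epsilon> * ln 2 / B"
  have \<delta>: "\<delta> > 0" using assms by (simp add: \<delta>_def)
  define L where "L = \<epsilon> * ln 2 - B - B * ln \<delta>"
  have "(real k + 1) powr B \<le> exp L * (2 powr \<epsilon>) ^ k" for k :: nat
  proof -
    have "ln (\<delta> * (real k + 1)) \<le> \<delta> * (real k + 1) - 1" using \<delta> by (intro ln_le_minus_one) simp
    then have "ln (real k + 1) \<le> \<delta> * (real k + 1) - 1 - ln \<delta>" using \<delta> by (simp add: ln_mult)
    then have "B * ln (real k + 1) \<le> B * (\<delta> * (real k + 1) - 1 - ln \<delta>)"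
      using assms by (intro mult_left_mono) auto
    also have "\<dots> = (B * \<delta>) * (real k + 1) - B - B * ln \<delta>" by (simp add: algebra_simps)
    also have "B * \<delta> = \<epsilon> * ln 2" using assms by (simp add: \<delta>_def)
    also have "\<epsilon> * ln 2 * (real k + 1) - B - B * ln \<delta> = L + real k * (\<epsilon> * ln 2)"
      by (simp add: L_def algebra_simps)
    finally have "exp (B * ln (real k + 1)) \<le> exp (L + real k * (\<epsilon> * ln 2))" by simp
    also have "\<dots> = exp L * exp (\<epsilon> * ln 2) ^ k" by (simp add: exp_add exp_of_nat_mult)
    finally show ?thesis by (simp add: powr_def)
  qed
  then show ?thesis by (intro that[of "exp L"]) auto
qed

text \<open>The weights on a block are at least \<open>2 ^ k\<close> to the power \<gamma>, and the
  logarithm is at most \<open>k + 1\<close>; lowering \<gamma> to \<eta> pays for its power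
  \<open>B\<close>.\<close>

lemma dyadic_block_bound:
  fixes a :: "nat \<Rightarrow> real"
  assumes AB: "A > 0" "B > 0" and \<eta>: "0 < \<eta>" "\<eta> < \<gamma>"
    and h: "\<And>m::nat. m \<ge> 2 \<Longrightarrow> (\<Sum>n=0..m. real n powr \<gamma> * (a n)\<^sup>2) \<le> A * ln (real m) powr B"
  shows "\<exists>C. \<forall>k. (\<Sum>j\<in>{2 ^ k..<2 ^ Suc k}. (a j)\<^sup>2) \<le> C * (2 powr (- \<eta>)) ^ k"
proof -
  obtain K where K: "K \<ge> 0" "\<And>k::nat. (real k + 1) powr B \<le> K * (2 powr (\<gamma> - \<eta>)) ^ k"
    using powr_le_geometric[OF AB(2), of "\<gamma> - \<eta>"] \<eta> by auto
  have "(\<Sum>j\<in>{2 ^ k..<2 ^ Suc k}. (a j)\<^sup>2) \<le> A * K * (2 powr (- \<eta>)) ^ k" for k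
  proof -
    define P where "P = (2 powr \<gamma>) ^ k"
    define E where "E = (\<Sum>j\<in>{2 ^ k..<2 ^ Suc k}. (a j)\<^sup>2)"
    have P0: "0 < P" by (simp add: P_def)
    have "P = (2 powr \<gamma>) powr real k" unfolding P_def by (subst powr_realpow) simp_all
    also have "\<dots> = (2 powr real k) powr \<gamma>" by (simp only: powr_powr mult.commute)
    also have "2 powr real k = real (2 ^ k)" by (subst powr_realpow) simp_all
    finally have P: "P = real (2 ^ k) powr \<gamma>" .
    have "P * E = (\<Sum>j\<in>{2 ^ k..<2 ^ Suc k}. real (2 ^ k) powr \<gamma> * (a j)\<^sup>2)"
      unfolding E_def P by (rule sum_distrib_left)
    also have "\<dots> \<le> (\<Sum>j\<in>{2 ^ k..<2 ^ Suc k}. real j powr \<gamma> * (a j)\<^sup>2)"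
    proof (intro sum_mono mult_right_mono powr_mono2)
      fix j assume "j \<in> {(2::nat) ^ k..<2 ^ Suc k}"
      then show "real (2 ^ k) \<le> real j" by (simp only: of_nat_le_iff atLeastLessThan_iff)
    qed (use \<eta> in auto)
    also have "\<dots> \<le> (\<Sum>j=0..2 ^ Suc k. real j powr \<gamma> * (a j)\<^sup>2)"
      by (rule sum_mono2) auto
    \<comment> \<open>The hypothesis at \<open>m = 2 ^ Suc k\<close>, which is at least 2 even for
      \<open>k = 0\<close>.\<close>
    also have "\<dots> \<le> A * ln (real (2 ^ Suc k)) powr B"
      using one_le_power[of "2::nat" k] by (intro h) simp
    finally have PE: "P * E \<le> A * ln (real (2 ^ Suc k)) powr B" .
    have l: "ln (real (2 ^ Suc k)) = (real k + 1) * ln 2"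
      unfolding of_nat_power of_nat_numeral by (subst ln_realpow) (simp add: algebra_simps)
    have "(real k + 1) * ln 2 \<le> (real k + 1) * 1"
      using ln_2_less_1 by (intro mult_mono) auto
    then have "ln (real (2 ^ Suc k)) powr B \<le> (real k + 1) powr B"
      unfolding l using AB by (intro powr_mono2) auto
    from mult_left_mono[OF order_trans[OF this K(2)], of A]
    have "P * E \<le> A * (K * (2 powr (\<gamma> - \<eta>)) ^ k)"
      using AB PE by linarith
    moreover have "(2 powr (\<gamma> - \<eta>)) ^ k = P * (2 powr (- \<eta>)) ^ k"
      unfolding P_def power_mult_distrib[symmetric] powr_add[symmetric] by simp
    ultimately have "P * E \<le> P * (A * K * (2 powr (- \<eta>)) ^ k)" by (simp only: mult_ac)
    then show ?thesis using P0 unfolding E_def by (simp only: mult_le_cancel_left_pos)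
  qed
  then show ?thesis by blast
qed

section \<open>The exceptional set and its complement\<close>

context circle_prob
begin

definition unbounded_set :: "complex set" where
  "unbounded_set = {z \<in> sphere 0 1.
     \<not> (Bseq (szego_rec (verblunsky M) z) \<and> Bseq (szego_rec (\<lambda>n. - verblunsky M n) z))}"

text \<open>Integer bounds make the good points a countable union of closed sets, with one ball
  growth constant on each.\<close>

definition bounded_set :: "nat \<Rightarrow> complex set" where
  "bounded_set C = {z \<in> sphere 0 1. \<forall>n. cmod (szego_rec (verblunsky M) z n) \<le> real C \<and>
     cmod (szego_rec (\<lambda>n. - verblunsky M n) z n) \<le> real C}"

lemma sphere_minus_unbounded_set: "sphere 0 1 - unbounded_set = (\<Union>C. bounded_set C)"
proof (intro equalityI subsetI)
  fix z assume z: "z \<in> sphere 0 1 - unbounded_set"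
  then obtain C1 C2 where "\<And>n. cmod (szego_rec (verblunsky M) z n) \<le> C1"
      "\<And>n. cmod (szego_rec (\<lambda>n. - verblunsky M n) z n) \<le> C2"
    unfolding unbounded_set_def Bseq_def by blast
  moreover obtain C :: nat where "max C1 C2 \<le> real C" using real_arch_simple by blast
  ultimately have "z \<in> bounded_set C"
    using z unfolding bounded_set_def by (auto intro: order_trans)
  then show "z \<in> (\<Union>C. bounded_set C)" by blast
next
  fix z assume "z \<in> (\<Union>C. bounded_set C)"
  then show "z \<in> sphere 0 1 - unbounded_set"
    unfolding unbounded_set_def bounded_set_def by (auto intro: BseqI')
qed

lemma sets_bounded_set: "bounded_set C \<in> sets circle_borel"
proof -
  have *: "closed {z. cmod (szego_rec \<alpha> z n) \<le> real C}" for \<alpha> n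
    by (intro closed_Collect_le continuous_on_norm continuous_szego_rec continuous_on_const)
  have "closed (\<Inter>n. {z. cmod (szego_rec (verblunsky M) z n) \<le> real C} \<inter>
      {z. cmod (szego_rec (\<lambda>n. - verblunsky M n) z n) \<le> real C})" (is "closed ?F")
    by (intro closed_INT closed_Int ballI *)
  then have "?F \<in> sets borel" by (rule borel_closed)
  moreover have "bounded_set C = sphere 0 1 \<inter> ?F" unfolding bounded_set_def by auto
  ultimately show ?thesis unfolding sets_restrict_space by (rule image_eqI[rotated])
qed

lemma supported_by_unbounded_set: "supported_by (singular_part circle_lebesgue M) unbounded_set"
proof (rule supported_by_singular_part)
  have sL: "sets circle_lebesgue = sets circle_borel" by (simp add: circle_lebesgue_def)
  show "sets circle_lebesgue = sets M" by (simp add: sL sets_M)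
  show "finite_measure M" by (rule finite_measure_axioms)
  have sp: "space M - unbounded_set = (\<Union>C. bounded_set C)"
    unfolding space_circle[OF sets_M] by (rule sphere_minus_unbounded_set)
  show "space M - unbounded_set \<in> sets M"
    unfolding sp sets_M by (rule sets.countable_UN) (use sets_bounded_set in blast)
  fix Z assume Z: "Z \<in> null_sets circle_lebesgue" "Z \<subseteq> space M - unbounded_set"
  have "Z \<inter> bounded_set C \<in> null_sets M" for C
  proof (rule null_set_if_linear_ball_growth[OF sets_M finite_measure_axioms])
    show "Z \<inter> bounded_set C \<in> null_sets circle_lebesgue"
      using null_set_Int2[OF Z(1), of "bounded_set C"] sets_bounded_set by (simp add: sL Int_commute)
    fix z and r :: real assume z: "z \<in> Z \<inter> bounded_set C" and r: "r > 0"
    show "measure M (cball z r \<inter> sphere 0 1) \<le> 32 * real C ^ 6 * r"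
      by (rule measure_ball_bounded_szego_rec[OF sets_M prob verblunsky(1) szego_rec_orthonormal _ _ _ r])
        (use z in \<open>simp_all add: bounded_set_def\<close>)
  qed
  then have "(\<Union>C. Z \<inter> bounded_set C) \<in> null_sets M" by (rule null_sets_UN)
  moreover have "Z = (\<Union>C. Z \<inter> bounded_set C)" using Z(2) unfolding sp by blast
  ultimately show "Z \<in> null_sets M" by simp
qed

lemma hausdorff_dim_unbounded_set:
  assumes AB: "A > 0" "B > 0" and \<gamma>: "0 < \<gamma>" "\<gamma> < 1"
    and h: "\<And>m::nat. m \<ge> 2 \<Longrightarrow>
      (\<Sum>n=0..m. real n powr \<gamma> * (cmod (verblunsky M n))\<^sup>2) \<le> A * ln (real m) powr B"
  shows "hausdorff_dim unbounded_set \<le> ennreal (2 * (1 - \<gamma>))"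
proof (rule hausdorff_dim_le)
  fix s assume s: "2 * (1 - \<gamma>) < s"
  \<comment> \<open>The midpoint lies strictly between \<open>1 - s / 2\<close> and
    \<open>\<gamma>\<close>; the maximum with \<open>\<gamma> / 2\<close> keeps
    \<open>\<eta>\<close> positive when \<open>s\<close> is large.\<close>
  define \<eta> where "\<eta> = max (\<gamma> / 2) ((\<gamma> + (1 - s / 2)) / 2)"
  have "\<gamma> / 2 \<le> \<eta>" "(\<gamma> + (1 - s / 2)) / 2 \<le> \<eta>" by (simp_all add: \<eta>_def)
  moreover have "1 - s / 2 < \<gamma>" using s by simp
  moreover from this have "\<eta> < \<gamma>" unfolding \<eta>_def using \<gamma> by simp
  ultimately have \<eta>: "0 < \<eta>" "\<eta> < \<gamma>" "2 * (1 - \<eta>) < s" using \<gamma> by simp_all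
  have "\<exists>C. \<forall>k. (\<Sum>j\<in>{2 ^ k..<2 ^ Suc k}. (cmod (verblunsky M j))\<^sup>2) \<le> C * (2 powr (- \<eta>)) ^ k"
    by (rule dyadic_block_bound[OF AB \<eta>(1,2)]) (rule h)
  then obtain C where C: "\<forall>k. (\<Sum>j\<in>{2 ^ k..<2 ^ Suc k}. (cmod (verblunsky M j))\<^sup>2) \<le> C * (2 powr (- \<eta>)) ^ k" ..
  show "hausdorff_measure s unbounded_set = 0"
    unfolding unbounded_set_def
  proof (rule hausdorff_measure_unbounded_szego_rec[OF verblunsky(1) \<eta>(1) _ \<eta>(3)])
    show "\<eta> < 1" using \<eta>(2) \<gamma> by simp
  qed (rule C[rule_format])
qed (use \<gamma> in simp)

lemma szego_matrix_entry_le: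
  assumes "z \<in> bounded_set C"
  shows "cmod (szego_matrix M n z $ i $ j) \<le> real C"
proof -
  define p where "p = poly (orthonormal_op M n) z"
  define q where "q = poly (second_kind (verblunsky M) n) z"
  have z: "cmod z = 1" using assms by (simp add: bounded_set_def)
  have pq: "cmod p \<le> real C" "cmod q \<le> real C"
    using assms poly_second_kind_circle[OF z, of "verblunsky M" n] verblunsky(1)
    by (simp_all add: bounded_set_def p_def q_def poly_orthonormal_op_circle[OF z])
  have dual: "poly (szego_dual (orthonormal_op M n)) z = z ^ n * cnj p"
      "poly (szego_dual (second_kind (verblunsky M) n)) z = z ^ n * cnj q"
    using degree_second_kind[of "verblunsky M" n] verblunsky(1)
    by (simp_all add: poly_szego_dual_circle[OF z] p_def q_def degree_orthonormal_op)
  have *: "cmod ((x + y) / 2) \<le> real C" "cmod ((x - y) / 2) \<le> real C"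
    if "cmod x \<le> real C" "cmod y \<le> real C" for x y
    using norm_triangle_ineq[of x y] norm_triangle_ineq4[of x y] that by (simp_all add: norm_divide)
  have d: "cmod (z ^ n * cnj p) \<le> real C" "cmod (z ^ n * cnj q) \<le> real C"
    using pq by (simp_all add: norm_mult norm_power z)
  have "(i = 1 \<or> i = 2) \<and> (j = 1 \<or> j = 2)" using exhaust_2 by blast
  then show ?thesis
    unfolding szego_matrix_def Let_def dual p_def[symmetric] q_def[symmetric]
    using *[OF pq] *[OF d] by (elim conjE disjE) (simp_all only: vector_2)
qed

lemma bdd_above_szego_matrix:
  assumes N: "matrix_norm N" and z: "z \<in> sphere 0 1 - unbounded_set"
  shows "bdd_above (range (\<lambda>n. N (szego_matrix M n z)))"
proof -
  obtain C where C: "z \<in> bounded_set C" using z unfolding sphere_minus_unbounded_set by blast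
  obtain K where K: "\<forall>X b. (\<forall>i j. cmod (X $ i $ j) \<le> b) \<longrightarrow> N X \<le> K * b"
    using matrix_norm_le_entries[OF N] by (elim exE)
  have "N (szego_matrix M n z) \<le> K * real C" for n
    by (rule K[rule_format]) (rule szego_matrix_entry_le[OF C])
  then show ?thesis by (intro bdd_aboveI2)
qed

end

theorem corollary1p2:
  fixes A B \<gamma> :: real and \<mu> :: "complex measure" and N :: "complex^2^2 \<Rightarrow> real"
  assumes "A > 0" and "B > 0" and "0 < \<gamma>" and "\<gamma> < 1"
    and "nontrivial_circle_prob \<mu>"
    and "\<And>m::nat. m \<ge> 2 \<Longrightarrow>
      (\<Sum>n=0..m. real n powr \<gamma> * (cmod (verblunsky \<mu> n))\<^sup>2) \<le> A * ln (real m) powr B"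
    and "matrix_norm N"
  shows "(\<exists>S. S \<subseteq> sphere 0 1 \<and> hausdorff_dim S \<le> ennreal (2 * (1 - \<gamma>)) \<and>
            (\<forall>z \<in> sphere 0 1 - S. bdd_above (range (\<lambda>n. N (szego_matrix \<mu> n z))))) \<and>
         (\<exists>S. S \<subseteq> sphere 0 1 \<and> hausdorff_dim S \<le> ennreal (2 * (1 - \<gamma>)) \<and>
            supported_by (singular_part circle_lebesgue \<mu>) S)"
proof -
  interpret circle_prob \<mu> by unfold_locales (rule assms(5))
  have "unbounded_set \<subseteq> sphere 0 1" by (auto simp: unbounded_set_def)
  moreover have "hausdorff_dim unbounded_set \<le> ennreal (2 * (1 - \<gamma>))"
    by (rule hausdorff_dim_unbounded_set[OF assms(1-4)]) (rule assms(6))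
  ultimately show ?thesis
    using bdd_above_szego_matrix[OF assms(7)] supported_by_unbounded_set
    by (intro conjI exI[of _ unbounded_set] ballI)
qed

end
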